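(* Let $K$ be a field with $\operatorname{char}(K)=p>0$, and let $E$ be a (non-empty) directed graph satisfying one of the following two conditions: (1) $E$ is a $p$-commutator graph; (3) $E^0=H\sqcup\{v\}$, where $H$ is a non-empty hereditary and saturated subset of $E^0$ such that the porcupine graph $P_H$ is a $p$-commutator graph, and $v$ is the unique infinite emitter of $E$ and is a source in $E$. Then $L_K(E)^-$ is a locally finite, infinite-dimensional, semisimple Lie algebra over $K$.
   Context: A directed graph $E=(E^0,E^1,r,s)$ consists of sets $E^0$ (vertices, non-empty), $E^1$ (edges), of arbitrary cardinality, and maps $r,s:E^1\to E^0$ (range, source). A vertex $v$ is a sink if $s^{-1}(v)=\varnothing$, a source if $r^{-1}(v)=\varnothing$, an infinite emitter if $s^{-1}(v)$ is infinite, and regular if it is neither a sink nor an infinite emitter; $\mathrm{Reg}(E)$ is the set of regular vertices. A path of length $n\ge 1$ is a sequence $\mu=e_1\cdots e_n$ of edges with $r(e_i)=s(e_{i+1})$, $s(\mu)=s(e_1)$, $r(\mu)=r(e_n)$; vertices are regarded as paths of length $0$. $\mathrm{Path}(E)$ is the set of finite paths. $E$ is acyclic if there is no path of length $\ge1$ with $s(\mu)=r(\mu)$. The Leavitt path algebra $L_K(E)$ is the associative (not necessarily unital) $K$-algebra generated by $E^0\cup E^1\cup\{e^*: e\in E^1\}$ subject to: $vv'=\delta_{v,v'}v$ for $v,v'\in E^0$; $s(e)e=er(e)=e$ and $r(e)e^*=e^*s(e)=e^*$ for $e\in E^1$; $e^*f=\delta_{e,f}r(e)$ for $e,f\in E^1$;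 $v=\sum_{s(e)=v}ee^*$ for $v\in\mathrm{Reg}(E)$. $L_K(E)^-$ is the Lie algebra on $L_K(E)$ with bracket $[a,b]=ab-ba$. A Lie algebra $L$ is locally finite if every finite subset lies in a finite-dimensional Lie subalgebra. A Lie subalgebra $L'$ of a locally finite Lie algebra is locally solvable if every finite-dimensional Lie subalgebra of $L'$ is solvable. The locally solvable radical of a locally finite Lie algebra $L$ is its unique maximal locally solvable ideal, which equals the sum of all locally solvable ideals of $L$. A locally finite Lie algebra is semisimple if its locally solvable radical is zero. A subset $H\subseteq E^0$ is hereditary if whenever $u\in H$ and there is a path from $u$ to $v$ then $v\in H$; it is saturated if for every regular vertex $v$, $r(s^{-1}(v))\subseteq H$ implies $v\in H$. For $u,v\in E^0$, $d(u,v)$ is the length of a shortest path from $u$ to $v$ (so $d(u,u)=0$), and $d(u,v)=\infty$ if there is none. For $m\in\mathbb N=\{0,1,2,\dots\}$, $D(u,m)=\{v\in E^0: d(u,v)\le m\}$. For a prime $p$, $E$ is a $p$-commutator graph if: (a) $E$ is acyclic; (b) every vertex of $E$ is regular; (c) for each $u\in E^0$ there is $m\in\mathbb N$ such that for all $w\in E^0$ with $d(u,w)=m+1$, the number of paths $q=e_1\cdots e_k\in\mathrm{Path}(E)$ with $s(q)=u$, $r(q)=w$ and $s(e_2),\dots,s(e_k)\in D(u,m)$ is a multiple of $p$. Porcupine graph: in the situation of (3) (where $E^0=H\sqcup\{v\}$, $H$ is hereditary and saturated, and $v$ is a source), the porcupine graph $P_H$ (of the admissible pair $(H,\varnothing)$)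 has vertex set $H\cup\{w^e: e\in s^{-1}(v)\}$ and edge set $\{e\in E^1: s(e)\in H\}\cup\{f^e: e\in s^{-1}(v)\}$, where $w^e$ and $f^e$ are new distinct symbols; the range and source maps agree with those of $E$ on edges $e$ with $s(e)\in H$, and $f^e$ has source $w^e$ and range $r(e)$. *)

theory Defs
  imports
    "HOL-Library.Extended_Nat"
    "HOL-Library.Poly_Mapping"
    "HOL-Algebra.QuotRing"
    "Graph_Theory.Digraph"
    "Graph_Theory.Arc_Walk"
    "Jordan_Normal_Form.VS_Connect"
begin

section \<open>Directed graphs\<close>

text \<open>
  A directed graph is a \<^typ>\<open>('v, 'e) pre_digraph\<close> satisfying \<^locale>\<open>wf_digraph\<close>; the source
  map is \<^const>\<open>tail\<close>, the range map is \<^const>\<open>head\<close>. Finite paths from \<open>u\<close> to \<open>v\<close> are the arc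
  lists \<open>q\<close> with \<open>pre_digraph.awalk E u q v\<close>; the empty list represents the path of length 0 at \<open>u\<close>.
\<close>

definition regular :: "('v, 'e) pre_digraph \<Rightarrow> 'v \<Rightarrow> bool" where
  "regular E v \<longleftrightarrow> v \<in> verts E \<and> out_arcs E v \<noteq> {} \<and> finite (out_arcs E v)"

definition infinite_emitter :: "('v, 'e) pre_digraph \<Rightarrow> 'v \<Rightarrow> bool" where
  "infinite_emitter E v \<longleftrightarrow> v \<in> verts E \<and> infinite (out_arcs E v)"

definition is_source :: "('v, 'e) pre_digraph \<Rightarrow> 'v \<Rightarrow> bool" where
  "is_source E v \<longleftrightarrow> v \<in> verts E \<and> in_arcs E v = {}"

definition acyclic_graph :: "('v, 'e) pre_digraph \<Rightarrow> bool" where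
  "acyclic_graph E \<longleftrightarrow> \<not> (\<exists>u q. q \<noteq> [] \<and> pre_digraph.awalk E u q u)"

definition hereditary :: "('v, 'e) pre_digraph \<Rightarrow> 'v set \<Rightarrow> bool" where
  "hereditary E H \<longleftrightarrow> H \<subseteq> verts E \<and> (\<forall>u\<in>H. \<forall>v q. pre_digraph.awalk E u q v \<longrightarrow> v \<in> H)"

definition saturated :: "('v, 'e) pre_digraph \<Rightarrow> 'v set \<Rightarrow> bool" where
  "saturated E H \<longleftrightarrow> (\<forall>v. regular E v \<and> head E ` out_arcs E v \<subseteq> H \<longrightarrow> v \<in> H)"

text \<open>The infimum over the empty set is \<open>\<infinity>\<close>.\<close>

definition gdist :: "('v, 'e) pre_digraph \<Rightarrow> 'v \<Rightarrow> 'v \<Rightarrow> enat" where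
  "gdist E u v = Inf {enat (length q) | q. pre_digraph.awalk E u q v}"

definition gball :: "('v, 'e) pre_digraph \<Rightarrow> 'v \<Rightarrow> nat \<Rightarrow> 'v set" where
  "gball E u m = {v \<in> verts E. gdist E u v \<le> enat m}"

text \<open>
  The use of \<^const>\<open>card\<close> is harmless: in an acyclic graph all of whose vertices are regular,
  \<open>gball E u m\<close> is finite and the paths counted below visit each of its vertices at most once,
  so there are finitely many of them.
\<close>

definition p_commutator_graph :: "nat \<Rightarrow> ('v, 'e) pre_digraph \<Rightarrow> bool" where
  "p_commutator_graph p E \<longleftrightarrow>
     acyclic_graph E \<and>
     (\<forall>v\<in>verts E. regular E v) \<and>
     (\<forall>u\<in>verts E. \<exists>m. \<forall>w\<in>verts E. gdist E u w = enat (m + 1) \<longrightarrow>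
        p dvd card {q. pre_digraph.awalk E u q w \<and> tail E ` set (tl q) \<subseteq> gball E u m})"

text \<open>
  The porcupine graph of \<open>(H, {})\<close> when \<open>verts E\<close> is the disjoint union of \<open>H\<close> and \<open>{v}\<close> and \<open>v\<close>
  is a source. The new vertex \<open>w\<^sup>e\<close> and the new edge \<open>f\<^sup>e\<close> are both represented by \<open>Inr e\<close>.
\<close>

definition porcupine ::
    "('v, 'e) pre_digraph \<Rightarrow> 'v set \<Rightarrow> 'v \<Rightarrow> ('v + 'e, 'e + 'e) pre_digraph" where
  "porcupine E H v =
     \<lparr>verts = Inl ` H \<union> Inr ` out_arcs E v,
      arcs = Inl ` {e \<in> arcs E. tail E e \<in> H} \<union> Inr ` out_arcs E v,
      tail = (\<lambda>x. case x of Inl e \<Rightarrow> Inl (tail E e) | Inr e \<Rightarrow> Inr e),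
      head = (\<lambda>x. case x of Inl e \<Rightarrow> Inl (head E e) | Inr e \<Rightarrow> Inl (head E e))\<rparr>"


section \<open>Leavitt path algebras\<close>

text \<open>
  Words form the free monoid under concatenation, written additively so that
  \<open>'g fword \<Rightarrow>\<^sub>0 'k\<close> carries the multiplication of the free unital associative algebra.
\<close>

datatype 'g fword = FWord (letters: "'g list")

instantiation fword :: (type) monoid_add
begin

definition zero_fword :: "'a fword" where
  "0 = FWord []"

definition plus_fword :: "'a fword \<Rightarrow> 'a fword \<Rightarrow> 'a fword" where
  "u + w = FWord (letters u @ letters w)"

instance
  by standard (simp_all add: zero_fword_def plus_fword_def)

end

datatype ('v, 'e) lpa_gen = Vertex 'v | Edge 'e | Ghost 'e

definition lpa_gens :: "('v, 'e) pre_digraph \<Rightarrow> ('v, 'e) lpa_gen set" where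
  "lpa_gens E = Vertex ` verts E \<union> Edge ` arcs E \<union> Ghost ` arcs E"

text \<open>
  The free non-unital algebra on a set \<open>X\<close> is spanned by the non-empty words over \<open>X\<close>. The field
  \<^const>\<open>one\<close> of the record has no meaning for a non-unital algebra. Scaling is multiplication by
  a multiple of the empty word.
\<close>

definition free_algebra :: "'g set \<Rightarrow> ('k::field, 'g fword \<Rightarrow>\<^sub>0 'k) module" where
  "free_algebra X =
     \<lparr>carrier = {f. \<forall>w\<in>Poly_Mapping.keys f. letters w \<noteq> [] \<and> set (letters w) \<subseteq> X},
      mult = (*), one = undefined, zero = 0, add = (+),
      smult = (\<lambda>c f. Poly_Mapping.single 0 c * f)\<rparr>"

definition gen :: "'g \<Rightarrow> 'g fword \<Rightarrow>\<^sub>0 'k::field" where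
  "gen x = Poly_Mapping.single (FWord [x]) 1"

text \<open>Each defining relation \<open>a = b\<close> is recorded as \<open>a - b\<close>.\<close>

definition lpa_relations ::
    "('v, 'e) pre_digraph \<Rightarrow> (('v, 'e) lpa_gen fword \<Rightarrow>\<^sub>0 'k::field) set" where
  "lpa_relations E =
     {gen (Vertex v) * gen (Vertex w) - (if v = w then gen (Vertex v) else 0) | v w.
        v \<in> verts E \<and> w \<in> verts E} \<union>
     {gen (Vertex (tail E e)) * gen (Edge e) - gen (Edge e) | e. e \<in> arcs E} \<union>
     {gen (Edge e) * gen (Vertex (head E e)) - gen (Edge e) | e. e \<in> arcs E} \<union>
     {gen (Vertex (head E e)) * gen (Ghost e) - gen (Ghost e) | e. e \<in> arcs E} \<union>
     {gen (Ghost e) * gen (Vertex (tail E e)) - gen (Ghost e) | e. e \<in> arcs E} \<union>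
     {gen (Ghost e) * gen (Edge f) - (if e = f then gen (Vertex (head E e)) else 0) | e f.
        e \<in> arcs E \<and> f \<in> arcs E} \<union>
     {gen (Vertex v) - (\<Sum>e\<in>out_arcs E v. gen (Edge e) * gen (Ghost e)) | v. regular E v}"

inductive_set ideal_generated :: "('k, 'a) module \<Rightarrow> 'a set \<Rightarrow> 'a set"
  for A :: "('k, 'a) module" and R :: "'a set" where
  zero: "\<zero>\<^bsub>A\<^esub> \<in> ideal_generated A R"
| rel: "x \<in> R \<Longrightarrow> x \<in> ideal_generated A R"
| add: "x \<in> ideal_generated A R \<Longrightarrow> y \<in> ideal_generated A R \<Longrightarrow> x \<oplus>\<^bsub>A\<^esub> y \<in> ideal_generated A R"
| smult: "x \<in> ideal_generated A R \<Longrightarrow> c \<odot>\<^bsub>A\<^esub> x \<in> ideal_generated A R"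
| left: "x \<in> ideal_generated A R \<Longrightarrow> a \<in> carrier A \<Longrightarrow> a \<otimes>\<^bsub>A\<^esub> x \<in> ideal_generated A R"
| right: "x \<in> ideal_generated A R \<Longrightarrow> a \<in> carrier A \<Longrightarrow> x \<otimes>\<^bsub>A\<^esub> a \<in> ideal_generated A R"

text \<open>
  This is \<^const>\<open>FactRing\<close> together with the induced scalar multiplication.
\<close>

definition quotient_algebra :: "('k, 'a) module \<Rightarrow> 'a set \<Rightarrow> ('k, 'a set) module" where
  "quotient_algebra A I =
     ring.extend (A Quot I)
       (module.fields (\<lambda>c X. \<Union>x\<in>X. I +>\<^bsub>A\<^esub> (c \<odot>\<^bsub>A\<^esub> x)))"

definition leavitt_path_algebra ::
    "'k::field itself \<Rightarrow> ('v, 'e) pre_digraph \<Rightarrow>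
     ('k, (('v, 'e) lpa_gen fword \<Rightarrow>\<^sub>0 'k) set) module" where
  "leavitt_path_algebra K E =
     (let F = free_algebra (lpa_gens E)
      in quotient_algebra F (ideal_generated F (lpa_relations E)))"


section \<open>Lie algebras\<close>

text \<open>The bracket of a Lie algebra is the field \<^const>\<open>mult\<close> of the record.\<close>

locale lie_algebra = vectorspace K L for K and L (structure) +
  assumes bracket_closed: "\<lbrakk>x \<in> carrier L; y \<in> carrier L\<rbrakk> \<Longrightarrow> x \<otimes> y \<in> carrier L"
    and bracket_add_left:
      "\<lbrakk>x \<in> carrier L; y \<in> carrier L; z \<in> carrier L\<rbrakk> \<Longrightarrow> (x \<oplus> y) \<otimes> z = (x \<otimes> z) \<oplus> (y \<otimes> z)"
    and bracket_add_right:
      "\<lbrakk>x \<in> carrier L; y \<in> carrier L; z \<in> carrier L\<rbrakk> \<Longrightarrow> x \<otimes> (y \<oplus> z) = (x \<otimes> y) \<oplus> (x \<otimes> z)"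
    and bracket_smult_left:
      "\<lbrakk>c \<in> carrier K; x \<in> carrier L; y \<in> carrier L\<rbrakk> \<Longrightarrow> (c \<odot> x) \<otimes> y = c \<odot> (x \<otimes> y)"
    and bracket_smult_right:
      "\<lbrakk>c \<in> carrier K; x \<in> carrier L; y \<in> carrier L\<rbrakk> \<Longrightarrow> x \<otimes> (c \<odot> y) = c \<odot> (x \<otimes> y)"
    and bracket_alternating: "x \<in> carrier L \<Longrightarrow> x \<otimes> x = \<zero>"
    and jacobi:
      "\<lbrakk>x \<in> carrier L; y \<in> carrier L; z \<in> carrier L\<rbrakk> \<Longrightarrow>
        (x \<otimes> (y \<otimes> z)) \<oplus> (y \<otimes> (z \<otimes> x)) \<oplus> (z \<otimes> (x \<otimes> y)) = \<zero>"

definition commutator_algebra :: "('k, 'a) module \<Rightarrow> ('k, 'a) module" where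
  "commutator_algebra A = A\<lparr>mult := (\<lambda>a b. (a \<otimes>\<^bsub>A\<^esub> b) \<ominus>\<^bsub>A\<^esub> (b \<otimes>\<^bsub>A\<^esub> a))\<rparr>"

definition lie_subalgebra :: "'k ring \<Rightarrow> ('k, 'a) module \<Rightarrow> 'a set \<Rightarrow> bool" where
  "lie_subalgebra K L U \<longleftrightarrow>
     VectorSpace.subspace K U L \<and> (\<forall>x\<in>U. \<forall>y\<in>U. x \<otimes>\<^bsub>L\<^esub> y \<in> U)"

definition lie_ideal :: "'k ring \<Rightarrow> ('k, 'a) module \<Rightarrow> 'a set \<Rightarrow> bool" where
  "lie_ideal K L I \<longleftrightarrow>
     VectorSpace.subspace K I L \<and> (\<forall>x\<in>carrier L. \<forall>y\<in>I. x \<otimes>\<^bsub>L\<^esub> y \<in> I)"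

definition finite_dimensional :: "'k ring \<Rightarrow> ('k, 'a) module \<Rightarrow> 'a set \<Rightarrow> bool" where
  "finite_dimensional K L U \<longleftrightarrow> vectorspace.fin_dim K (L\<lparr>carrier := U\<rparr>)"

primrec derived_series :: "'k ring \<Rightarrow> ('k, 'a) module \<Rightarrow> 'a set \<Rightarrow> nat \<Rightarrow> 'a set" where
  "derived_series K L U 0 = U"
| "derived_series K L U (Suc n) =
     LinearCombinations.module.span K L
       {x \<otimes>\<^bsub>L\<^esub> y | x y. x \<in> derived_series K L U n \<and> y \<in> derived_series K L U n}"

definition solvable :: "'k ring \<Rightarrow> ('k, 'a) module \<Rightarrow> 'a set \<Rightarrow> bool" where
  "solvable K L U \<longleftrightarrow> (\<exists>n. derived_series K L U n = {\<zero>\<^bsub>L\<^esub>})"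

definition locally_finite :: "'k ring \<Rightarrow> ('k, 'a) module \<Rightarrow> bool" where
  "locally_finite K L \<longleftrightarrow>
     (\<forall>S. finite S \<and> S \<subseteq> carrier L \<longrightarrow>
        (\<exists>U. lie_subalgebra K L U \<and> finite_dimensional K L U \<and> S \<subseteq> U))"

definition locally_solvable :: "'k ring \<Rightarrow> ('k, 'a) module \<Rightarrow> 'a set \<Rightarrow> bool" where
  "locally_solvable K L U \<longleftrightarrow>
     (\<forall>W. W \<subseteq> U \<and> lie_subalgebra K L W \<and> finite_dimensional K L W \<longrightarrow> solvable K L W)"

text \<open>
  For a locally finite Lie algebra the maximal locally solvable ideal is unique, so that the
  description below denotes it.
\<close>

definition locally_solvable_radical :: "'k ring \<Rightarrow> ('k, 'a) module \<Rightarrow> 'a set" where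
  "locally_solvable_radical K L =
     (THE R. lie_ideal K L R \<and> locally_solvable K L R \<and>
        (\<forall>J. lie_ideal K L J \<and> locally_solvable K L J \<and> R \<subseteq> J \<longrightarrow> J = R))"

definition semisimple :: "'k ring \<Rightarrow> ('k, 'a) module \<Rightarrow> bool" where
  "semisimple K L \<longleftrightarrow> locally_solvable_radical K L = {\<zero>\<^bsub>L\<^esub>}"

end

theory Submission
  imports Defs
begin

text \<open>
  In both cases \<open>E\<close> is acyclic and every vertex emits an edge.
  Acyclicity makes \<open>L\<^sub>K(E)\<close> locally finite-dimensional: finitely many vertices and edges support only
  finitely many monomials \<open>a b\<^sup>*\<close>, and these are closed under multiplication. There are infinitely many
  vertices, which are linearly independent because they are nonzero orthogonal idempotents.

  For semisimplicity, let \<open>x \<noteq> 0\<close> lie in a Lie ideal \<open>J\<close>, and let \<open>F\<close> be the finite set of vertices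
  supporting \<open>x\<close>. Since \<open>x\<close> can be multiplied by ever longer paths without becoming \<open>0\<close>, there are
  paths \<open>a, b\<close> into a vertex \<open>w\<close> outside \<open>F\<close> with \<open>a\<^sup>* x b = c w\<close> and \<open>c \<noteq> 0\<close>. For a path \<open>d\<close> of
  length at least \<open>2\<close> from \<open>w\<close> to a vertex outside \<open>F\<close>, the brackets with \<open>b\<close>, \<open>d\<close> and \<open>a\<^sup>*\<close> reduce to
  products, so \<open>c d = [a\<^sup>*, [[x, b], d]]\<close> lies in \<open>J\<close>. The path \<open>d\<close> is an off-diagonal matrix unit
  of a copy of the \<open>3 \<times> 3\<close> matrices, so \<open>J\<close> contains all off-diagonal ones; as each of these is a
  bracket of two others in every characteristic, \<open>J\<close> is not locally solvable.
\<close>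

section \<open>Families satisfying the Leavitt relations\<close>

lemma (in wf_digraph) awalk_closed_imp_Nil:
  assumes "acyclic_graph G" "awalk u q u"
  shows "q = []"
  using assms by (auto simp: acyclic_graph_def)

lemma (in wf_digraph) acyclic_awalk_distinct_verts:
  assumes "acyclic_graph G" "awalk u q v"
  shows "distinct (awalk_verts u q)"
proof (rule ccontr)
  assume "\<not> ?thesis"
  then obtain r w where "0 < length r" "awalk w r w"
    using awalk_not_distinct_decomp[OF assms(2)] by blast
  then show False using awalk_closed_imp_Nil[OF assms(1)] by auto
qed

lemma (in wf_digraph) acyclic_awalk_distinct:
  assumes "acyclic_graph G" "awalk u q v"
  shows "distinct q"
  using acyclic_awalk_distinct_verts[OF assms] assms(2)
  by (metis distinct_verts_imp_distinct)

text \<open>Elements of any ring satisfying the relations, so that the computations run with class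
  operations instead of cosets. Nothing is assumed to be nonzero at this stage.\<close>

locale leavitt_family = vector_space scale + wf_digraph E
  for scale :: "'k::field \<Rightarrow> 'r::ring \<Rightarrow> 'r" (infixr \<open>*s\<close> 75)
    and E :: "('v, 'e) pre_digraph" +
  fixes V :: "'v \<Rightarrow> 'r" and S T :: "'e \<Rightarrow> 'r"
  assumes scale_mult_left: "(c *s x) * y = c *s (x * y)"
    and scale_mult_right: "x * (c *s y) = c *s (x * y)"
    and V_V: "\<lbrakk>v \<in> verts E; w \<in> verts E\<rbrakk> \<Longrightarrow> V v * V w = (if v = w then V v else 0)"
    and V_S: "e \<in> arcs E \<Longrightarrow> V (tail E e) * S e = S e"
    and S_V: "e \<in> arcs E \<Longrightarrow> S e * V (head E e) = S e"
    and V_T: "e \<in> arcs E \<Longrightarrow> V (head E e) * T e = T e"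
    and T_V: "e \<in> arcs E \<Longrightarrow> T e * V (tail E e) = T e"
    and T_S: "\<lbrakk>e \<in> arcs E; f \<in> arcs E\<rbrakk> \<Longrightarrow> T e * S f = (if e = f then V (head E e) else 0)"
    and V_regular: "regular E v \<Longrightarrow> V v = (\<Sum>e\<in>out_arcs E v. S e * T e)"
begin

section \<open>Paths, ghost paths and their products\<close>

text \<open>The start vertex is an argument because the empty list does not determine it.\<close>

primrec path_el :: "'v \<Rightarrow> 'e list \<Rightarrow> 'r" where
  "path_el u [] = V u"
| "path_el u (e # q) = S e * path_el (head E e) q"

primrec ghost_el :: "'v \<Rightarrow> 'e list \<Rightarrow> 'r" where
  "ghost_el u [] = V u"
| "ghost_el u (e # q) = ghost_el (head E e) q * T e"

lemma V_path: "awalk u q w \<Longrightarrow> V u * path_el u q = path_el u q"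
  by (cases q) (auto simp: awalk_simps V_V V_S mult.assoc[symmetric])

lemma path_V: "awalk u q w \<Longrightarrow> path_el u q * V w = path_el u q"
  by (induction q arbitrary: u) (auto simp: awalk_simps V_V mult.assoc)

lemma V_ghost: "awalk u q w \<Longrightarrow> V w * ghost_el u q = ghost_el u q"
  by (induction q arbitrary: u) (auto simp: awalk_simps V_V mult.assoc[symmetric])

lemma ghost_V: "awalk u q w \<Longrightarrow> ghost_el u q * V u = ghost_el u q"
  by (cases q) (auto simp: awalk_simps V_V T_V mult.assoc)

lemma path_append:
  "awalk u q w \<Longrightarrow> awalk w q' w' \<Longrightarrow> path_el u (q @ q') = path_el u q * path_el w q'"
  by (induction q arbitrary: u) (auto simp: awalk_simps V_path mult.assoc)

lemma ghost_append:
  "awalk u q w \<Longrightarrow> awalk w q' w' \<Longrightarrow> ghost_el u (q @ q') = ghost_el w q' * ghost_el u q"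
  by (induction q arbitrary: u) (auto simp: awalk_simps ghost_V mult.assoc)

lemma path_single: "e \<in> arcs E \<Longrightarrow> path_el u [e] = S e"
  by (simp add: S_V)

lemma V_other:
  assumes "awalk u q w" "v \<in> verts E"
  shows "v \<noteq> u \<Longrightarrow> V v * path_el u q = 0"
    and "v \<noteq> w \<Longrightarrow> path_el u q * V v = 0"
    and "v \<noteq> w \<Longrightarrow> V v * ghost_el u q = 0"
    and "v \<noteq> u \<Longrightarrow> ghost_el u q * V v = 0"
proof -
  have uw: "u \<in> verts E" "w \<in> verts E"
    using assms(1) awalk_hd_in_verts awalk_last_in_verts by auto
  show "v \<noteq> u \<Longrightarrow> V v * path_el u q = 0"
    using V_path[OF assms(1)] V_V[OF assms(2) uw(1)] by (metis mult.assoc mult_zero_left)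
  show "v \<noteq> w \<Longrightarrow> path_el u q * V v = 0"
    using path_V[OF assms(1)] V_V[OF uw(2) assms(2)] by (metis mult.assoc mult_zero_right)
  show "v \<noteq> w \<Longrightarrow> V v * ghost_el u q = 0"
    using V_ghost[OF assms(1)] V_V[OF assms(2) uw(2)] by (metis mult.assoc mult_zero_left)
  show "v \<noteq> u \<Longrightarrow> ghost_el u q * V v = 0"
    using ghost_V[OF assms(1)] V_V[OF uw(1) assms(2)] by (metis mult.assoc mult_zero_right)
qed

text \<open>Equal first edges cancel by \<open>T_S\<close> and distinct ones give 0, so the
  comparison of the two lists ends when one is exhausted or the letters disagree. This is the rule
  behind all later products of monomials.\<close>

lemma ghost_path_cases:
  assumes "awalk u q w" "awalk u q' w'"
  obtains (prefix) r where "q' = q @ r" "awalk w r w'" "ghost_el u q * path_el u q' = path_el w r"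
  | (suffix) r where "q = q' @ r" "awalk w' r w" "ghost_el u q * path_el u q' = ghost_el w' r"
  | (zero) "ghost_el u q * path_el u q' = 0"
proof -
  have "(\<exists>r. q' = q @ r \<and> awalk w r w' \<and> ghost_el u q * path_el u q' = path_el w r) \<or>
      (\<exists>r. q = q' @ r \<and> awalk w' r w \<and> ghost_el u q * path_el u q' = ghost_el w' r) \<or>
      ghost_el u q * path_el u q' = 0"
    using assms
  proof (induction q arbitrary: u q')
    case Nil
    then show ?case by (auto simp: awalk_simps V_path)
  next
    case (Cons e q)
    show ?case
    proof (cases q')
      case Nil
      with Cons.prems ghost_V[OF Cons.prems(1)] show ?thesis
        by (auto simp: awalk_simps)
    next
      case (Cons f q'')
      have e: "e \<in> arcs E" "awalk (head E e) q w" and f: "f \<in> arcs E" "awalk (head E f) q'' w'"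
        using Cons.prems Cons by (auto simp: awalk_simps)
      have prod: "ghost_el u (e # q) * path_el u q' =
          (if e = f then ghost_el (head E e) q * path_el (head E e) q'' else 0)"
      proof -
        have "ghost_el u (e # q) * path_el u q' =
            ghost_el (head E e) q * ((T e * S f) * path_el (head E f) q'')"
          by (simp add: Cons mult.assoc)
        then show ?thesis using T_S[OF e(1) f(1)] V_path[OF f(2)] by auto
      qed
      show ?thesis
        using Cons.IH[OF e(2), of q''] f(2) Cons prod by (cases "e = f") auto
    qed
  qed
  then show ?thesis using that by blast
qed

lemma ghost_path_other:
  assumes "awalk u q w" "awalk u' q' w'" "u \<noteq> u'"
  shows "ghost_el u q * path_el u' q' = 0"
  using V_other(1)[OF assms(2) awalk_hd_in_verts[OF assms(1)] assms(3)] ghost_V[OF assms(1)]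
  by (metis mult.assoc mult_zero_right)

lemma ghost_path: "awalk u q w \<Longrightarrow> ghost_el u q * path_el u q = V w"
proof (induction q arbitrary: u)
  case (Cons e q)
  then have e: "e \<in> arcs E" "awalk (head E e) q w" by (auto simp: awalk_simps)
  have "ghost_el u (e # q) * path_el u (e # q) =
      ghost_el (head E e) q * ((T e * S e) * path_el (head E e) q)"
    by (simp add: mult.assoc)
  then show ?case using Cons.IH[OF e(2)] T_S[OF e(1) e(1)] V_path[OF e(2)] by simp
qed (auto simp: awalk_simps V_V)

section \<open>Monomials and finite-dimensional subalgebras\<close>

text \<open>The usual spanning elements of a Leavitt path algebra, with sources confined to
  \<open>F\<close> and edges to \<open>G\<close> in order to cut out finite-dimensional subalgebras
  of an acyclic family.\<close>

definition monomials :: "'v set \<Rightarrow> 'e set \<Rightarrow> 'r set" where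
  "monomials F G = {path_el u a * ghost_el v b | u a v b w.
     awalk u a w \<and> awalk v b w \<and> u \<in> F \<and> v \<in> F \<and> set a \<subseteq> G \<and> set b \<subseteq> G}"

text \<open>The ambient type may be larger than the algebra that the family generates, so the latter
  is kept as a subspace.\<close>

definition alg :: "'r set" where
  "alg = span (monomials UNIV UNIV)"

lemma monomialsI:
  "awalk u a w \<Longrightarrow> awalk v b w \<Longrightarrow> u \<in> F \<Longrightarrow> v \<in> F \<Longrightarrow> set a \<subseteq> G \<Longrightarrow> set b \<subseteq> G \<Longrightarrow>
    path_el u a * ghost_el v b \<in> monomials F G"
  unfolding monomials_def by blast

lemma monomials_mono: "F \<subseteq> F' \<Longrightarrow> G \<subseteq> G' \<Longrightarrow> monomials F G \<subseteq> monomials F' G'"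
  unfolding monomials_def by blast

text \<open>Cancelling the inner ghost path against the inner path leaves a tail of one of them,
  which is absorbed by the outer path or the outer ghost path. Hence no new source vertex and no new
  edge appears.\<close>

lemma monomials_mult:
  assumes "x \<in> monomials F G" "y \<in> monomials F G"
  shows "x * y \<in> insert 0 (monomials F G)"
proof -
  obtain u a v b w where x: "x = path_el u a * ghost_el v b" "awalk u a w" "awalk v b w"
    "u \<in> F" "v \<in> F" "set a \<subseteq> G" "set b \<subseteq> G"
    using assms(1) unfolding monomials_def by blast
  obtain u' a' v' b' w' where y: "y = path_el u' a' * ghost_el v' b'" "awalk u' a' w'"
    "awalk v' b' w'" "u' \<in> F" "v' \<in> F" "set a' \<subseteq> G" "set b' \<subseteq> G"
    using assms(2) unfolding monomials_def by blast
  have xy: "x * y = path_el u a * (ghost_el v b * path_el u' a') * ghost_el v' b'"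
    by (simp add: x y mult.assoc)
  show ?thesis
  proof (cases "v = u'")
    case False
    then show ?thesis using xy ghost_path_other[OF x(3) y(2)] by simp
  next
    case True
    with y(2) have y2: "awalk v a' w'" by simp
    from x(3) y2 show ?thesis
    proof (cases rule: ghost_path_cases)
      case (prefix r)
      have "x * y = path_el u (a @ r) * ghost_el v' b'"
        using xy prefix path_append[OF x(2) prefix(2)] True by simp
      moreover have "awalk u (a @ r) w'" using x(2) prefix(2) by auto
      ultimately show ?thesis using x y prefix by (auto intro!: monomialsI)
    next
      case (suffix r)
      have "x * y = path_el u a * ghost_el w' r * ghost_el v' b'"
        using xy suffix(3) True by simp
      then have "x * y = path_el u a * ghost_el v' (b' @ r)"
        using ghost_append[OF y(3) suffix(2)] by (simp add: mult.assoc)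
      moreover have "awalk v' (b' @ r) w" using y(3) suffix(2) by auto
      ultimately show ?thesis using x y suffix by (auto intro!: monomialsI)
    next
      case zero
      with xy True show ?thesis by simp
    qed
  qed
qed

lemma span_mult_closed:
  assumes B: "\<And>x y. x \<in> B \<Longrightarrow> y \<in> B \<Longrightarrow> x * y \<in> span B"
    and "x \<in> span B" "y \<in> span B"
  shows "x * y \<in> span B"
proof -
  have "x * y \<in> span B" if "x \<in> B" for x
    using \<open>y \<in> span B\<close>
  proof (induction rule: span_induct_alt)
    case (step c z y)
    then show ?case
      using B[OF \<open>x \<in> B\<close>, of z] by (auto simp: distrib_left scale_mult_right intro: span_add span_scale)
  qed (simp add: span_zero)
  with \<open>x \<in> span B\<close> show ?thesis
    by (induction rule: span_induct_alt)
      (auto simp: distrib_right scale_mult_left span_zero intro: span_add span_scale)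
qed

lemma span_monomials_mult:
  "x \<in> span (monomials F G) \<Longrightarrow> y \<in> span (monomials F G) \<Longrightarrow> x * y \<in> span (monomials F G)"
  using span_mult_closed[of "monomials F G" x y] monomials_mult[of _ F G]
  by (metis insert_iff span_base span_zero)

lemma alg_mult: "x \<in> alg \<Longrightarrow> y \<in> alg \<Longrightarrow> x * y \<in> alg"
  unfolding alg_def by (rule span_monomials_mult)

lemma subspace_alg: "subspace alg"
  by (simp add: alg_def)

lemma path_in_alg: "awalk u q w \<Longrightarrow> path_el u q \<in> alg"
  using monomialsI[of u q w w "[]" UNIV UNIV] path_V awalk_last_in_verts
  unfolding alg_def by (auto simp: awalk_simps intro!: span_base)

lemma ghost_in_alg: "awalk u q w \<Longrightarrow> ghost_el u q \<in> alg"
  using monomialsI[of w "[]" w u q UNIV UNIV] V_ghost awalk_last_in_verts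
  unfolding alg_def by (auto simp: awalk_simps intro!: span_base)

lemma V_in_alg: "v \<in> verts E \<Longrightarrow> V v \<in> alg"
  using path_in_alg[of v "[]" v] by (simp add: awalk_simps)

lemma S_in_alg: "e \<in> arcs E \<Longrightarrow> S e \<in> alg"
  using path_in_alg[of "tail E e" "[e]" "head E e"] by (simp add: awalk_simps S_V)

lemma T_in_alg: "e \<in> arcs E \<Longrightarrow> T e \<in> alg"
  using ghost_in_alg[of "tail E e" "[e]" "head E e"] by (simp add: awalk_simps V_T)

text \<open>Acyclicity forbids repeated edges, and a finite set has only finitely many
  duplicate-free lists.\<close>

lemma finite_monomials:
  assumes "acyclic_graph E" "finite F" "finite G"
  shows "finite (monomials F G)"
proof -
  let ?D = "{a. set a \<subseteq> G \<and> distinct a}"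
  have "finite ?D" using assms(3) by (rule finite_subset_distinct)
  then have "finite ((\<lambda>(u, a, v, b). path_el u a * ghost_el v b) ` (F \<times> ?D \<times> F \<times> ?D))"
    using assms(2) by auto
  moreover have "monomials F G \<subseteq> (\<lambda>(u, a, v, b). path_el u a * ghost_el v b) ` (F \<times> ?D \<times> F \<times> ?D)"
  proof
    fix x assume "x \<in> monomials F G"
    then obtain u a v b w where x: "x = path_el u a * ghost_el v b" "awalk u a w" "awalk v b w"
      "u \<in> F" "v \<in> F" "set a \<subseteq> G" "set b \<subseteq> G"
      unfolding monomials_def by blast
    then have "(u, a, v, b) \<in> F \<times> ?D \<times> F \<times> ?D"
      using acyclic_awalk_distinct[OF assms(1)] by auto
    then show "x \<in> (\<lambda>(u, a, v, b). path_el u a * ghost_el v b) ` (F \<times> ?D \<times> F \<times> ?D)"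
      by (rule rev_image_eqI) (simp add: x(1))
  qed
  ultimately show ?thesis by (rule finite_subset[rotated])
qed

lemma finite_support:
  assumes "finite X" "X \<subseteq> alg"
  shows "\<exists>F G. finite F \<and> finite G \<and> X \<subseteq> span (monomials F G)"
  using assms
proof (induction rule: finite_induct)
  case empty
  then show ?case by blast
next
  case (insert x X)
  have "x \<in> span (monomials UNIV UNIV)" using insert.prems by (simp add: alg_def)
  then have "\<exists>F G. finite F \<and> finite G \<and> x \<in> span (monomials F G)"
  proof (induction rule: span_induct_alt)
    case base
    then show ?case by (blast intro: span_zero)
  next
    case (step c x y)
    then obtain F G where FG: "finite F" "finite G" "y \<in> span (monomials F G)" by auto
    obtain u a v b w where x: "x = path_el u a * ghost_el v b" "awalk u a w" "awalk v b w"
      using step(1) unfolding monomials_def by blast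
    let ?F = "insert u (insert v F)" and ?G = "set a \<union> set b \<union> G"
    have "x \<in> monomials ?F ?G" unfolding x(1) using x by (intro monomialsI) auto
    moreover have "y \<in> span (monomials ?F ?G)"
      using FG(3) span_mono[OF monomials_mono[of F ?F G ?G]] by auto
    ultimately have "c *s x + y \<in> span (monomials ?F ?G)"
      by (blast intro: span_add span_scale span_base)
    then show ?case using FG by (intro exI[of _ ?F] exI[of _ ?G]) auto
  qed
  then obtain F G where 1: "finite F" "finite G" "x \<in> span (monomials F G)" by blast
  from insert obtain F' G' where 2: "finite F'" "finite G'" "X \<subseteq> span (monomials F' G')" by auto
  have "insert x X \<subseteq> span (monomials (F \<union> F') (G \<union> G'))"
    using 1 2 span_mono[OF monomials_mono[of F "F \<union> F'" G "G \<union> G'"]]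
      span_mono[OF monomials_mono[of F' "F \<union> F'" G' "G \<union> G'"]] by auto
  with 1 2 show ?case by (meson finite_UnI)
qed

text \<open>The associative form of local finiteness: \<open>span B\<close> is closed under
  products, hence also under commutators.\<close>

lemma alg_locally_finite:
  assumes "acyclic_graph E" "finite X" "X \<subseteq> alg"
  shows "\<exists>B. finite B \<and> B \<subseteq> alg \<and> X \<subseteq> span B \<and> (\<forall>x\<in>B. \<forall>y\<in>B. x * y \<in> span B)"
proof -
  obtain F G where FG: "finite F" "finite G" "X \<subseteq> span (monomials F G)"
    using finite_support[OF assms(2,3)] by blast
  have "monomials F G \<subseteq> alg"
    using monomials_mono[of F UNIV G UNIV] span_superset unfolding alg_def by blast
  moreover have "x * y \<in> span (monomials F G)" if "x \<in> monomials F G" "y \<in> monomials F G" for x y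
    using that by (intro span_monomials_mult span_base)
  ultimately show ?thesis
    using FG(3) finite_monomials[OF assms(1) FG(1,2)] by blast
qed

section \<open>Local units\<close>

lemma sum_V_V:
  assumes "finite F" "F \<subseteq> verts E" "v \<in> verts E"
  shows "(\<Sum>u\<in>F. V u) * V v = (if v \<in> F then V v else 0)"
    and "V v * (\<Sum>u\<in>F. V u) = (if v \<in> F then V v else 0)"
proof -
  have "(\<Sum>u\<in>F. V u) * V v = (\<Sum>u\<in>F. if u = v then V v else 0)"
    unfolding sum_distrib_right using assms by (intro sum.cong) (auto simp: V_V)
  then show "(\<Sum>u\<in>F. V u) * V v = (if v \<in> F then V v else 0)" using assms by simp
  have "V v * (\<Sum>u\<in>F. V u) = (\<Sum>u\<in>F. if u = v then V v else 0)"
    unfolding sum_distrib_left using assms by (intro sum.cong) (auto simp: V_V)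
  then show "V v * (\<Sum>u\<in>F. V u) = (if v \<in> F then V v else 0)" using assms by simp
qed

text \<open>A monomial is fixed on either side by the source vertices of its two paths. Quantifying
  over all larger \<open>F'\<close> lets the finite sets of two summands be merged in the
  induction.\<close>

lemma local_unit:
  assumes "x \<in> alg"
  shows "\<exists>F. finite F \<and> F \<subseteq> verts E \<and>
    (\<forall>F'. finite F' \<and> F \<subseteq> F' \<and> F' \<subseteq> verts E \<longrightarrow> (\<Sum>v\<in>F'. V v) * x = x \<and> x * (\<Sum>v\<in>F'. V v) = x)"
  using assms unfolding alg_def
proof (induction rule: span_induct_alt)
  case base
  then show ?case by auto
next
  case (step c x y)
  obtain u a v b w where x: "x = path_el u a * ghost_el v b" "awalk u a w" "awalk v b w"
    using step(1) unfolding monomials_def by blast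
  have uv: "u \<in> verts E" "v \<in> verts E" using x awalk_hd_in_verts by auto
  have Vx: "V u * x = x"
    unfolding x(1) mult.assoc[symmetric] V_path[OF x(2)] ..
  have xV: "x * V v = x"
    unfolding x(1) mult.assoc ghost_V[OF x(3)] ..
  obtain F where F: "finite F" "F \<subseteq> verts E"
    "\<forall>F'. finite F' \<and> F \<subseteq> F' \<and> F' \<subseteq> verts E \<longrightarrow> (\<Sum>v\<in>F'. V v) * y = y \<and> y * (\<Sum>v\<in>F'. V v) = y"
    using step(2) by (elim exE conjE) (rule that)
  show ?case
  proof (intro exI[of _ "insert u (insert v F)"] conjI allI impI)
    fix F' assume F': "finite F' \<and> insert u (insert v F) \<subseteq> F' \<and> F' \<subseteq> verts E"
    let ?e = "\<Sum>v\<in>F'. V v"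
    have y: "?e * y = y" "y * ?e = y" using F(3)[rule_format, of F'] F' by auto
    have "?e * V u = V u" "V v * ?e = V v" using sum_V_V[of F'] F' uv by auto
    then have "?e * (V u * x) = V u * x" "(x * V v) * ?e = x * V v"
      by (metis mult.assoc, metis mult.assoc)
    then have "?e * x = x" "x * ?e = x" using Vx xV by simp_all
    with y show "?e * (c *s x + y) = c *s x + y" "(c *s x + y) * ?e = c *s x + y"
      by (simp_all add: distrib_left distrib_right scale_mult_left scale_mult_right)
  qed (use F uv in auto)
qed

text \<open>A vertex outside \<open>F\<close> is orthogonal to the local unit supported on
  \<open>F\<close>.\<close>

lemma vanish_off_finite:
  assumes "x \<in> alg"
  shows "\<exists>F. finite F \<and> F \<subseteq> verts E \<and> (\<forall>w\<in>verts E - F. V w * x = 0 \<and> x * V w = 0)"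
proof -
  obtain F where F: "finite F" "F \<subseteq> verts E" "(\<Sum>v\<in>F. V v) * x = x" "x * (\<Sum>v\<in>F. V v) = x"
    using local_unit[OF assms] by blast
  have "V w * x = 0 \<and> x * V w = 0" if "w \<in> verts E - F" for w
  proof -
    have "V w * (\<Sum>v\<in>F. V v) = 0" "(\<Sum>v\<in>F. V v) * V w = 0"
      using sum_V_V[of F w] F that by auto
    then show ?thesis using F(3,4) by (metis mult.assoc mult_zero_left mult_zero_right)
  qed
  with F show ?thesis by blast
qed

lemma nonzero_V:
  assumes "x \<in> alg" "x \<noteq> 0"
  shows "\<exists>u\<in>verts E. x * V u \<noteq> 0"
proof (rule ccontr)
  assume *: "\<not> ?thesis"
  obtain F where F: "finite F" "F \<subseteq> verts E" "x * (\<Sum>v\<in>F. V v) = x"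
    using local_unit[OF assms(1)] by blast
  have "x * (\<Sum>v\<in>F. V v) = (\<Sum>v\<in>F. x * V v)" by (rule sum_distrib_left)
  also have "\<dots> = 0" using * F(2) by (intro sum.neutral) auto
  finally show False using F(3) assms(2) by simp
qed

end


section \<open>Acyclic graphs without sinks\<close>

text \<open>Infinite emitters are allowed, which lets one argument serve both kinds of graphs.
  \<open>V_nonzero\<close> has to be assumed, since the zero family satisfies all the
  relations.\<close>

locale acyclic_leavitt_family = leavitt_family scale E V S T
  for scale :: "'k::field \<Rightarrow> 'r::ring \<Rightarrow> 'r" (infixr \<open>*s\<close> 75)
    and E :: "('v, 'e) pre_digraph" and V S T +
  assumes acyclic: "acyclic_graph E"
    and no_sink: "v \<in> verts E \<Longrightarrow> \<exists>e\<in>arcs E. tail E e = v"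
    and V_nonzero: "v \<in> verts E \<Longrightarrow> V v \<noteq> 0"
begin

section \<open>Orthogonality of paths with a common range\<close>

lemma S_nonzero: "e \<in> arcs E \<Longrightarrow> S e \<noteq> 0"
  using T_S[of e e] V_nonzero[of "head E e"] by auto

text \<open>If one path extends the other and both end at \<open>w\<close>, the leftover piece is a
  closed walk and hence empty.\<close>

lemma ghost_path_orthogonal:
  assumes "awalk u q w" "awalk u' q' w"
  shows "ghost_el u q * path_el u' q' = (if u = u' \<and> q = q' then V w else 0)"
proof (cases "u = u'")
  case True
  then have "awalk u q' w" using assms by simp
  with assms(1) show ?thesis
  proof (cases rule: ghost_path_cases)
    case (prefix r)
    then have "q = q'" using awalk_closed_imp_Nil[OF acyclic] by auto
    then show ?thesis using True ghost_path[OF assms(1)] by simp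
  next
    case (suffix r)
    then have "q = q'" using awalk_closed_imp_Nil[OF acyclic] by auto
    then show ?thesis using True ghost_path[OF assms(1)] by simp
  next
    case zero
    then have "q \<noteq> q'"
      using ghost_path[OF assms(1)] V_nonzero awalk_last_in_verts[OF assms(1)] by auto
    with zero True show ?thesis by simp
  qed
qed (use ghost_path_other assms in auto)

definition paths_to :: "'v \<Rightarrow> 'r set" where
  "paths_to w = {path_el u q | u q. awalk u q w}"

text \<open>By orthogonality \<open>ghost_el u q\<close> reads off the coefficient of the path
  \<open>q\<close>, so any path with a nonzero coefficient serves.\<close>

lemma span_paths_to_coefficient:
  assumes "y \<in> span (paths_to w)" "y \<noteq> 0"
  shows "\<exists>u q c. awalk u q w \<and> c \<noteq> 0 \<and> ghost_el u q * y = c *s V w"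
proof -
  obtain t r where t: "finite t" "t \<subseteq> paths_to w" "y = (\<Sum>a\<in>t. r a *s a)"
    using assms(1) unfolding span_explicit by blast
  have "\<exists>a\<in>t. r a \<noteq> 0"
  proof (rule ccontr)
    assume "\<not> ?thesis"
    then have "y = 0" unfolding t(3) by (intro sum.neutral) auto
    with assms(2) show False by simp
  qed
  then obtain a where a: "a \<in> t" "r a \<noteq> 0" by blast
  then obtain u q where uq: "a = path_el u q" "awalk u q w"
    using t(2) unfolding paths_to_def by blast
  have "ghost_el u q * (r b *s b) = (if b = a then r a *s V w else 0)" if bt: "b \<in> t" for b
  proof -
    obtain u' q' where b: "b = path_el u' q'" "awalk u' q' w"
      using bt t(2) unfolding paths_to_def by blast
    show ?thesis
      using ghost_path_orthogonal[OF uq(2) b(2)] ghost_path[OF uq(2)]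
      by (auto simp: b(1) uq(1) scale_mult_right)
  qed
  then have "ghost_el u q * y = (\<Sum>b\<in>t. if b = a then r a *s V w else 0)"
    unfolding t(3) sum_distrib_left by (intro sum.cong) auto
  also have "\<dots> = r a *s V w" using t(1) a(1) by simp
  finally show ?thesis using uq(2) a(2) by blast
qed

section \<open>Extending nonzero products by an edge\<close>

text \<open>For finite \<open>G\<close> inside \<open>out_arcs E u\<close> this is the idempotent
  complementary in \<open>V u\<close> to the idempotents \<open>S e * T e\<close> with
  \<open>e\<close> in \<open>G\<close>. It is 0 if \<open>u\<close> is regular and \<open>G\<close>
  consists of all its edges.\<close>

definition co_range :: "'v \<Rightarrow> 'e set \<Rightarrow> 'r" where
  "co_range u G = V u - (\<Sum>e\<in>G. S e * T e)"

lemma V_co_range: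
  assumes "v \<in> verts E" "u \<in> verts E" "G \<subseteq> out_arcs E u"
  shows "V v * co_range u G = (if v = u then co_range u G else 0)"
proof -
  have "V v * (S e * T e) = (if v = u then S e * T e else 0)" if "e \<in> G" for e
  proof -
    have e: "e \<in> arcs E" "tail E e = u" using assms(3) that by auto
    have "V v * (S e * T e) = V v * V u * (S e * T e)"
      using V_S[OF e(1)] e(2) by (metis mult.assoc)
    then show ?thesis using V_V[OF assms(1,2)] V_S[OF e(1)] e(2) by (auto simp: mult.assoc[symmetric])
  qed
  then have "V v * (\<Sum>e\<in>G. S e * T e) = (if v = u then (\<Sum>e\<in>G. S e * T e) else 0)"
    by (simp add: sum_distrib_left)
  then show ?thesis
    using V_V[OF assms(1,2)] by (simp add: co_range_def right_diff_distrib)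
qed

lemma T_co_range:
  assumes "finite G" "G \<subseteq> out_arcs E u" "e \<in> G"
  shows "T e * co_range u G = 0"
proof -
  have e: "e \<in> arcs E" "tail E e = u" using assms by auto
  have "T e * (S f * T f) = (if f = e then T e else 0)" if "f \<in> G" for f
    using T_S[OF e(1), of f] V_T[OF e(1)] that assms(2) by (auto simp: mult.assoc[symmetric])
  then have "T e * (\<Sum>f\<in>G. S f * T f) = (\<Sum>f\<in>G. if f = e then T e else 0)"
    unfolding sum_distrib_left by (intro sum.cong) auto
  then show ?thesis
    using T_V[OF e(1)] e(2) assms by (simp add: co_range_def right_diff_distrib)
qed

lemma co_range_S:
  assumes "finite G" "G \<subseteq> out_arcs E u" "e \<in> out_arcs E u" "e \<notin> G"
  shows "co_range u G * S e = S e"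
proof -
  have e: "e \<in> arcs E" "tail E e = u" using assms by auto
  have "(\<Sum>f\<in>G. S f * T f) * S e = (\<Sum>f\<in>G. S f * (T f * S e))"
    by (simp add: sum_distrib_right mult.assoc)
  also have "\<dots> = 0"
    using T_S[OF _ e(1)] assms(2,4) by (intro sum.neutral) auto
  finally show ?thesis using V_S[OF e(1)] e(2) by (simp add: co_range_def left_diff_distrib)
qed

text \<open>
  At an infinite emitter no relation expresses \<open>V u\<close> through edges. The following lemma replaces it:
  the correction factor \<open>co_range u G\<close> fixes every edge outside \<open>G\<close>, of which there are infinitely many.
\<close>

lemma real_part_at_vertex:
  assumes "x \<in> alg" "u \<in> verts E"
  shows "\<exists>G y. finite G \<and> G \<subseteq> out_arcs E u \<and> y \<in> span (paths_to u) \<and>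
    (\<forall>G'. finite G' \<and> G \<subseteq> G' \<and> G' \<subseteq> out_arcs E u \<longrightarrow> x * co_range u G' = y * co_range u G')"
  using assms(1) unfolding alg_def
proof (induction rule: span_induct_alt)
  case base
  show ?case by (intro exI[of _ "{}"] exI[of _ 0]) (auto simp: span_zero)
next
  case (step c x z)
  obtain s a v b w where x: "x = path_el s a * ghost_el v b" "awalk s a w" "awalk v b w"
    using step(1) unfolding monomials_def by blast
  obtain G y where G: "finite G" "G \<subseteq> out_arcs E u" "y \<in> span (paths_to u)"
    "\<forall>G'. finite G' \<and> G \<subseteq> G' \<and> G' \<subseteq> out_arcs E u \<longrightarrow> z * co_range u G' = y * co_range u G'"
    using step(2) by (elim exE conjE) (rule that)
  have v: "v \<in> verts E" using awalk_hd_in_verts[OF x(3)] .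
  have "\<exists>H y'. finite H \<and> H \<subseteq> out_arcs E u \<and> y' \<in> span (paths_to u) \<and>
    (\<forall>G'. finite G' \<and> H \<subseteq> G' \<and> G' \<subseteq> out_arcs E u \<longrightarrow> x * co_range u G' = y' * co_range u G')"
  proof (cases "v = u")
    case False
    have "x * co_range u G' = 0" if "G' \<subseteq> out_arcs E u" for G'
    proof -
      have "x * co_range u G' = x * V v * co_range u G'"
        unfolding x(1) mult.assoc[of _ _ "V v"] ghost_V[OF x(3)] ..
      also have "\<dots> = 0" using V_co_range[OF v assms(2) that] False by (simp add: mult.assoc)
      finally show ?thesis .
    qed
    then show ?thesis by (intro exI[of _ "{}"] exI[of _ 0]) (auto simp: span_zero)
  next
    case True
    show ?thesis
    proof (cases b)
      case Nil
      then have w: "w = u" using x(3) True by (auto simp: awalk_simps)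
      then have "x = path_el s a" using path_V[OF x(2)] Nil True by (simp add: x(1))
      then have "x \<in> span (paths_to u)" using x(2) w by (auto simp: paths_to_def intro!: span_base)
      then show ?thesis by blast
    next
      case (Cons e b')
      then have e: "e \<in> out_arcs E u" using x(3) True by (auto simp: awalk_simps)
      \<comment> \<open>The rightmost factor of this monomial is \<open>T e\<close>, which
        annihilates \<open>co_range u G'\<close> as soon as \<open>e\<close> belongs to
        \<open>G'\<close>. So the monomial contributes nothing to the real part.\<close>
      have "x * co_range u G' = 0" if "finite G'" "{e} \<subseteq> G'" "G' \<subseteq> out_arcs E u" for G'
        using T_co_range[OF that(1,3), of e] that(2) by (simp add: x(1) Cons mult.assoc)
      then show ?thesis using e
        by (intro exI[of _ "{e}"] exI[of _ 0]) (auto simp: span_zero)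
    qed
  qed
  then obtain H y' where H: "finite H" "H \<subseteq> out_arcs E u" "y' \<in> span (paths_to u)"
    "\<forall>G'. finite G' \<and> H \<subseteq> G' \<and> G' \<subseteq> out_arcs E u \<longrightarrow> x * co_range u G' = y' * co_range u G'"
    by (elim exE conjE) (rule that)
  show ?case
  proof (intro exI[of _ "G \<union> H"] exI[of _ "c *s y' + y"] conjI allI impI)
    fix G' assume "finite G' \<and> G \<union> H \<subseteq> G' \<and> G' \<subseteq> out_arcs E u"
    then have "x * co_range u G' = y' * co_range u G'" "z * co_range u G' = y * co_range u G'"
      using G(4) H(4) by auto
    then show "(c *s x + z) * co_range u G' = (c *s y' + y) * co_range u G'"
      by (simp add: distrib_right scale_mult_left)
  qed (use G H in \<open>auto intro: span_add span_scale\<close>)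
qed

text \<open>At a regular vertex, \<open>V_regular\<close> writes \<open>x * V u\<close> through the
  products \<open>x * S e\<close>. At an infinite emitter, \<open>V u\<close> is
  \<open>co_range u G\<close> plus a finite sum over \<open>G\<close>: the first part is controlled
  by a combination \<open>y\<close> of real paths, the second by the edges in
  \<open>G\<close>.\<close>

lemma extend_edge:
  assumes "x \<in> alg" "u \<in> verts E" "x * V u \<noteq> 0"
  shows "\<exists>e\<in>arcs E. tail E e = u \<and> x * S e \<noteq> 0"
proof (rule ccontr)
  assume "\<not> ?thesis"
  then have zero: "x * S e = 0" if "e \<in> out_arcs E u" for e using that by auto
  show False
  proof (cases "regular E u")
    case True
    have "x * V u = (\<Sum>e\<in>out_arcs E u. x * S e * T e)"
      unfolding V_regular[OF True] by (simp add: sum_distrib_left mult.assoc)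
    also have "\<dots> = 0" using zero by (intro sum.neutral) simp
    finally show False using assms(3) by simp
  next
    case False
    have inf: "infinite (out_arcs E u)"
      using False no_sink[OF assms(2)] assms(2) by (auto simp: regular_def)
    obtain G y where G: "finite G" "G \<subseteq> out_arcs E u" "y \<in> span (paths_to u)"
      "x * co_range u G = y * co_range u G"
      using real_part_at_vertex[OF assms(1,2)] by blast
    \<comment> \<open>An edge outside \<open>G\<close> is fixed by \<open>co_range u G\<close>, so
      \<open>x\<close> and \<open>y\<close> have the same product with it.\<close>
    have "infinite (out_arcs E u - G)" using inf G(1) by simp
    then obtain f where f: "f \<in> out_arcs E u" "f \<notin> G" by (metis Diff_iff ex_in_conv finite.emptyI)
    have "y * S f = y * co_range u G * S f"
      using co_range_S[OF G(1,2) f] by (simp add: mult.assoc)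
    also have "\<dots> = x * S f"
      using co_range_S[OF G(1,2) f] G(4) by (metis mult.assoc)
    finally have yf: "y * S f = 0" using zero f by simp
    \<comment> \<open>A nonzero combination of paths into \<open>u\<close> cannot be killed by
      appending \<open>f\<close>: extracting a coefficient first would give
      \<open>c *s S f = 0\<close> with \<open>c\<close> nonzero.\<close>
    have "y = 0"
    proof (rule ccontr)
      assume "y \<noteq> 0"
      then obtain t q c where c: "c \<noteq> 0" "ghost_el t q * y = c *s V u"
        using span_paths_to_coefficient[OF G(3)] by blast
      have "c *s (V u * S f) = ghost_el t q * (y * S f)"
        using c(2) by (metis mult.assoc scale_mult_left)
      then have "c *s S f = 0" using yf V_S[of f] f by auto
      then show False using c(1) S_nonzero[of f] f by auto
    qed
    then have "x * co_range u G = 0" using G(4) by simp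
    moreover have "x * (\<Sum>e\<in>G. S e * T e) = (\<Sum>e\<in>G. x * S e * T e)"
      by (simp add: sum_distrib_left mult.assoc)
    moreover have "\<dots> = 0" using zero G(2) by (intro sum.neutral) auto
    ultimately have "x * V u = 0" by (simp add: co_range_def right_diff_distrib)
    then show False using assms(3) by simp
  qed
qed

section \<open>Extension by long paths and reduction to a vertex\<close>

lemma extend_path:
  assumes "x \<in> alg" "u \<in> verts E" "x * V u \<noteq> 0"
  shows "\<exists>b w. awalk u b w \<and> length b = n \<and> x * path_el u b \<noteq> 0"
proof (induction n)
  case 0
  show ?case using assms by (intro exI[of _ "[]"] exI[of _ u]) (auto simp: awalk_simps)
next
  case (Suc n)
  then obtain b w where b: "awalk u b w" "length b = n" "x * path_el u b \<noteq> 0" by blast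
  have "x * path_el u b \<in> alg" using assms(1) path_in_alg[OF b(1)] by (rule alg_mult)
  moreover have "x * path_el u b * V w \<noteq> 0" using path_V[OF b(1)] b(3) by (simp add: mult.assoc)
  ultimately obtain e where e: "e \<in> arcs E" "tail E e = w" "x * path_el u b * S e \<noteq> 0"
    using extend_edge awalk_last_in_verts[OF b(1)] by blast
  have we: "awalk w [e] (head E e)" using e by (auto simp: awalk_simps)
  have "awalk u (b @ [e]) (head E e)" using b(1) we by auto
  moreover have "path_el u (b @ [e]) = path_el u b * S e"
    using path_append[OF b(1) we] path_single[OF e(1)] by simp
  ultimately show ?case
    using b(2) e(3) by (intro exI[of _ "b @ [e]"] exI[of _ "head E e"]) (auto simp: mult.assoc)
qed

text \<open>After \<open>n\<close> edges, append \<open>card F\<close> more. By acyclicity this tail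
  visits \<open>card F + 1\<close> distinct vertices, so one of them lies outside \<open>F\<close>.
  Cutting the tail there keeps the product nonzero, because the longer product factors through
  it.\<close>

lemma extend_path_avoiding:
  assumes "x \<in> alg" "u \<in> verts E" "x * V u \<noteq> 0" "finite F"
  shows "\<exists>b w. awalk u b w \<and> n \<le> length b \<and> w \<notin> F \<and> x * path_el u b \<noteq> 0"
proof -
  obtain b w where b: "awalk u b w" "length b = n" "x * path_el u b \<noteq> 0"
    using extend_path[OF assms(1-3)] by blast
  let ?y = "x * path_el u b"
  have "?y \<in> alg" using assms(1) path_in_alg[OF b(1)] by (rule alg_mult)
  moreover have "?y * V w \<noteq> 0" using path_V[OF b(1)] b(3) by (simp add: mult.assoc)
  ultimately obtain b' w' where b': "awalk w b' w'" "length b' = card F" "?y * path_el w b' \<noteq> 0"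
    using extend_path[of ?y w "card F"] awalk_last_in_verts[OF b(1)] by blast
  have "card (set (awalk_verts w b')) = Suc (card F)"
    using distinct_card[OF acyclic_awalk_distinct_verts[OF acyclic b'(1)]] b'(2)
    by (simp add: length_awalk_verts)
  then have "\<not> set (awalk_verts w b') \<subseteq> F"
    using card_mono[OF assms(4), of "set (awalk_verts w b')"] by auto
  then obtain z where z: "z \<in> set (awalk_verts w b')" "z \<notin> F" by blast
  then obtain q r where qr: "b' = q @ r" "awalk w q z" "awalk z r w'"
    using awalk_decomp[OF b'(1)] by blast
  have "x * path_el u (b @ q) = ?y * path_el w q"
    using path_append[OF b(1) qr(2)] by (simp add: mult.assoc)
  moreover have "?y * path_el w q * path_el z r \<noteq> 0"
    using b'(3) path_append[OF qr(2,3)] qr(1) by (simp add: mult.assoc)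
  ultimately have "x * path_el u (b @ q) \<noteq> 0" by auto
  moreover have "awalk u (b @ q) z" using b(1) qr(2) by auto
  ultimately show ?thesis using z(2) b(2) by (intro exI[of _ "b @ q"]) auto
qed

text \<open>A path at least as long as the ghost part of a monomial either cancels it entirely or
  gives 0. An element involves finitely many monomials, so one bound \<open>N\<close>
  suffices.\<close>

lemma eventually_real_paths:
  assumes "x \<in> alg"
  shows "\<exists>N. \<forall>u b w. awalk u b w \<and> N \<le> length b \<longrightarrow> x * path_el u b \<in> span (paths_to w)"
  using assms unfolding alg_def
proof (induction rule: span_induct_alt)
  case base
  then show ?case by (auto simp: span_zero)
next
  case (step c x y)
  obtain s a v d r where x: "x = path_el s a * ghost_el v d" "awalk s a r" "awalk v d r"
    using step(1) unfolding monomials_def by blast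
  obtain N where N: "\<And>u b w. awalk u b w \<Longrightarrow> N \<le> length b \<Longrightarrow> y * path_el u b \<in> span (paths_to w)"
    using step(2) by blast
  have "x * path_el u b \<in> span (paths_to w)" if b: "awalk u b w" "length d \<le> length b" for u b w
  proof (cases "u = v")
    case False
    then show ?thesis using ghost_path_other[OF x(3) b(1)] by (simp add: x(1) mult.assoc span_zero)
  next
    case True
    with b(1) have vb: "awalk v b w" by simp
    have xb: "x * path_el u b = path_el s a * (ghost_el v d * path_el v b)"
      using True by (simp add: x(1) mult.assoc)
    from x(3) vb show ?thesis
    proof (cases rule: ghost_path_cases)
      case (prefix q)
      then have "x * path_el u b = path_el s (a @ q)" using xb path_append[OF x(2)] by simp
      moreover have "awalk s (a @ q) w" using x(2) prefix by auto
      ultimately show ?thesis unfolding paths_to_def by (intro span_base) blast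
    next
      case (suffix q)
      \<comment> \<open>The length bound leaves only the boundary case in which \<open>b\<close>
        equals the ghost part \<open>d\<close>.\<close>
      then have "q = []" using b(2) by simp
      then have "w = r" "ghost_el v d * path_el v b = V r"
        using suffix by (auto simp: awalk_simps)
      then have "x * path_el u b = path_el s a" using xb path_V[OF x(2)] by simp
      then show ?thesis using x(2) \<open>w = r\<close> by (auto simp: paths_to_def intro!: span_base)
    next
      case zero
      with xb show ?thesis by (simp add: span_zero)
    qed
  qed
  with N have "(c *s x + y) * path_el u b \<in> span (paths_to w)"
    if "awalk u b w" "max N (length d) \<le> length b" for u b w
    using that by (simp add: distrib_right scale_mult_left span_add span_scale)
  then show ?case by blast
qed

text \<open>An acyclic form of the reduction theorem for Leavitt path algebras. A long path
  \<open>b\<close> removes all ghost edges from \<open>x\<close>, then a ghost path isolates one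
  coefficient. The control over \<open>w\<close> is what later turns brackets into products.\<close>

lemma reduction:
  assumes "x \<in> alg" "x \<noteq> 0" "finite F"
  shows "\<exists>u b w t a c. awalk u b w \<and> awalk t a w \<and> w \<notin> F \<and> c \<noteq> 0 \<and>
    ghost_el t a * (x * path_el u b) = c *s V w"
proof -
  obtain u where u: "u \<in> verts E" "x * V u \<noteq> 0" using nonzero_V[OF assms(1,2)] by blast
  obtain N where N: "\<And>u b w. awalk u b w \<Longrightarrow> N \<le> length b \<Longrightarrow> x * path_el u b \<in> span (paths_to w)"
    using eventually_real_paths[OF assms(1)] by blast
  obtain b w where b: "awalk u b w" "N \<le> length b" "w \<notin> F" "x * path_el u b \<noteq> 0"
    using extend_path_avoiding[OF assms(1) u assms(3)] by blast
  obtain t a c where "awalk t a w" "c \<noteq> 0" "ghost_el t a * (x * path_el u b) = c *s V w"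
    using span_paths_to_coefficient[OF N[OF b(1,2)] b(4)] by blast
  with b show ?thesis by blast
qed

section \<open>Infinite dimension\<close>

text \<open>Were the vertex set finite, it could itself be taken as the set to be avoided.\<close>

lemma infinite_verts:
  assumes "verts E \<noteq> {}"
  shows "infinite (verts E)"
proof
  assume fin: "finite (verts E)"
  obtain u where u: "u \<in> verts E" using assms by blast
  then have "V u * V u \<noteq> 0" using V_V V_nonzero by auto
  then obtain b w where "awalk u b w" "w \<notin> verts E"
    using extend_path_avoiding[OF V_in_alg[OF u] u _ fin] by blast
  then show False using awalk_last_in_verts by blast
qed

lemma alg_infinite_dimensional:
  assumes "verts E \<noteq> {}" "finite B"
  shows "\<not> alg \<subseteq> span B"
proof
  assume alg: "alg \<subseteq> span B"
  have inj: "inj_on V (verts E)"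
    using V_V V_nonzero by (metis inj_onI)
  have "independent (V ` verts E)"
    unfolding independent_explicit_module
  proof (intro allI impI)
    fix t c x assume t: "finite t" "t \<subseteq> V ` verts E" "(\<Sum>v\<in>t. c v *s v) = 0" "x \<in> t"
    then obtain w where w: "w \<in> verts E" "x = V w" by blast
    have "V w * (c y *s y) = (if y = x then c x *s x else 0)" if yt: "y \<in> t" for y
    proof -
      obtain v where "v \<in> verts E" "y = V v" using yt t(2) by blast
      then show ?thesis using w V_V[of w v] V_V[of w w] by (auto simp: scale_mult_right)
    qed
    then have "V w * (\<Sum>v\<in>t. c v *s v) = (\<Sum>y\<in>t. if y = x then c x *s x else 0)"
      unfolding sum_distrib_left by (intro sum.cong) auto
    then have "c x *s x = 0" using t by simp
    then show "c x = 0" using V_nonzero w by simp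
  qed
  then show False
    using independent_span_bound[OF assms(2)] alg V_in_alg infinite_verts[OF assms(1)] inj
    by (metis finite_imageD image_subset_iff subset_iff)
qed

section \<open>Matrix units in Lie ideals\<close>

text \<open>Bracketing with a matrix unit replaces one index, since the product in the opposite
  order vanishes when the resulting unit is off-diagonal. With three indices, all off-diagonal
  positions can be reached from one by such moves.\<close>

lemma matrix_units_in_lie_ideal:
  fixes e :: "nat \<Rightarrow> nat \<Rightarrow> 'r"
  assumes unit: "\<And>i j k l. i < 3 \<Longrightarrow> j < 3 \<Longrightarrow> k < 3 \<Longrightarrow> l < 3 \<Longrightarrow>
      e i j * e k l = (if j = k then e i l else 0)"
    and e_alg: "\<And>i j. i < 3 \<Longrightarrow> j < 3 \<Longrightarrow> e i j \<in> alg"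
    and J: "subspace J" "\<And>a x. a \<in> alg \<Longrightarrow> x \<in> J \<Longrightarrow> a * x - x * a \<in> J"
    and start: "e 0 2 \<in> J"
    and ij: "i < 3" "j < 3" "i \<noteq> j"
  shows "e i j \<in> J"
proof -
  have left: "e i j \<in> J" if "e k j \<in> J" "i < 3" "j < 3" "k < 3" "i \<noteq> j" for i j k
    using J(2)[OF e_alg[OF that(2,4)] that(1)] that by (simp add: unit)
  have right: "e i j \<in> J" if "e i k \<in> J" "i < 3" "j < 3" "k < 3" "i \<noteq> j" for i j k
    using subspace_neg[OF J(1) J(2)[OF e_alg[OF that(4,3)] that(1)]] that by (simp add: unit)
  have 01: "e 0 1 \<in> J" using right[OF start] by simp
  have 12: "e 1 2 \<in> J" using left[OF start] by simp
  have 10: "e 1 0 \<in> J" using right[OF 12] by simp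
  have 21: "e 2 1 \<in> J" using left[OF 01] by simp
  have 20: "e 2 0 \<in> J" using left[OF 10] by simp
  have "i \<in> {0, 1, 2}" "j \<in> {0, 1, 2}" using ij by auto
  then show ?thesis using ij start 01 12 10 21 20 by auto
qed

text \<open>\<open>R\<close> is a certificate of nonsolvability: its members are brackets of its
  members, so it survives in every derived term. \<open>B\<close> bounds the dimension of the
  subalgebra in which this takes place.\<close>

lemma lie_ideal_nonsolvable:
  assumes J: "subspace J" "J \<subseteq> alg" "\<And>a x. a \<in> alg \<Longrightarrow> x \<in> J \<Longrightarrow> a * x - x * a \<in> J"
    and x: "x \<in> J" "x \<noteq> 0"
  shows "\<exists>B R. finite B \<and> B \<subseteq> alg \<and> (\<forall>x\<in>B. \<forall>y\<in>B. x * y \<in> span B) \<and> R \<subseteq> J \<inter> span B \<and>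
    R \<noteq> {} \<and> 0 \<notin> R \<and> (\<forall>x\<in>R. \<exists>y\<in>R. \<exists>z\<in>R. x = y * z - z * y)"
proof -
  have xA: "x \<in> alg" using J(2) x(1) by blast
  obtain F where F: "finite F" "F \<subseteq> verts E" "\<And>w. w \<in> verts E \<Longrightarrow> w \<notin> F \<Longrightarrow> V w * x = 0"
    using vanish_off_finite[OF xA] by blast
  obtain u b w t a c where red: "awalk u b w" "awalk t a w" "w \<notin> F" "c \<noteq> 0"
    "ghost_el t a * (x * path_el u b) = c *s V w"
    using reduction[OF xA x(2) F(1)] by blast
  have w: "w \<in> verts E" using awalk_last_in_verts[OF red(1)] .
  \<comment> \<open>A path ending outside \<open>F\<close> annihilates \<open>x\<close> from the
    left, so its bracket with \<open>x\<close> is, up to sign, the product in the other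
    order.\<close>
  have Vx: "path_el s q * x = 0" if "awalk s q v" "v \<notin> F" for s q v
    using path_V[OF that(1)] F(3)[OF awalk_last_in_verts[OF that(1)] that(2)]
    by (metis mult.assoc mult_zero_right)
  have right: "y * path_el s q \<in> J" if "y \<in> J" "awalk s q v" "path_el s q * y = 0" for y s q v
    using subspace_neg[OF J(1) J(3)[OF path_in_alg[OF that(2)] that(1)]] that(3) by simp
  define y where "y = x * path_el u b"
  have yJ: "y \<in> J" unfolding y_def using right[OF x(1) red(1) Vx[OF red(1,3)]] .
  have "V w * V w \<noteq> 0" using V_V[OF w w] V_nonzero[OF w] by simp
  \<comment> \<open>Length at least 2 provides an intermediate vertex, hence the three distinct
    vertices that index the matrix units.\<close>
  then obtain d w2 where d: "awalk w d w2" "2 \<le> length d" "w2 \<notin> F"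
    using extend_path_avoiding[OF V_in_alg[OF w] w _ F(1), of 2] by blast
  obtain e d1 where d1: "d = e # d1" "d1 \<noteq> []" using d(2) by (cases d) (auto simp: Suc_le_eq)
  define w1 where "w1 = head E e"
  have w1: "awalk w [e] w1" "awalk w1 d1 w2" using d(1) d1 by (auto simp: awalk_simps w1_def)
  have w2: "w2 \<in> verts E" using awalk_last_in_verts[OF d(1)] .
  have neq: "w \<noteq> w1" "w1 \<noteq> w2" "w \<noteq> w2"
    using awalk_closed_imp_Nil[OF acyclic] w1 d d1 by auto
  have ydJ: "y * path_el w d \<in> J"
    using right[OF yJ d(1)] Vx[OF d(1,3)] by (simp add: y_def mult.assoc[symmetric])
  \<comment> \<open>\<open>d\<close> ends at \<open>w2\<close>, whereas the ghost path
    \<open>a\<close> begins at \<open>w\<close>, so the second half of the bracket with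
    \<open>ghost_el t a\<close> vanishes.\<close>
  have dg: "path_el w d * ghost_el t a = 0"
    using V_other(2)[OF d(1) w] neq V_ghost[OF red(2)] by (metis mult.assoc mult_zero_left)
  have "ghost_el t a * (y * path_el w d) - y * path_el w d * ghost_el t a \<in> J"
    using J(3)[OF ghost_in_alg[OF red(2)] ydJ] .
  moreover have "ghost_el t a * (y * path_el w d) = c *s path_el w d"
  proof -
    have "ghost_el t a * (y * path_el w d) = (ghost_el t a * y) * path_el w d"
      by (simp add: mult.assoc)
    also have "ghost_el t a * y = c *s V w" using red(5) by (simp add: y_def)
    finally show ?thesis using V_path[OF d(1)] by (simp add: scale_mult_left)
  qed
  ultimately have "c *s path_el w d \<in> J" using dg by (simp add: mult.assoc)
  then have "inverse c *s (c *s path_el w d) \<in> J" by (rule subspace_scale[OF J(1)])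
  then have dJ: "path_el w d \<in> J" using red(4) by simp
  \<comment> \<open>The paths \<open>d\<close>, \<open>d1\<close> and the empty one start at three
    different vertices and all end at \<open>w2\<close>. By orthogonality the products of these
    paths with their ghosts are matrix units, and the unit at position (0, 2) is \<open>d\<close>
    itself.\<close>
  define v where "v = (\<lambda>i::nat. if i = 0 then w else if i = 1 then w1 else w2)"
  define q where "q = (\<lambda>i::nat. if i = 0 then d else if i = 1 then d1 else [])"
  define m where "m = (\<lambda>i j. path_el (v i) (q i) * ghost_el (v j) (q j))"
  have vq: "awalk (v i) (q i) w2" for i
    using d(1) w1(2) w2 by (auto simp: v_def q_def awalk_simps)
  have orth: "ghost_el (v i) (q i) * path_el (v j) (q j) = (if i = j then V w2 else 0)"
    if "i < 3" "j < 3" for i j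
  proof -
    have "i \<in> {0, 1, 2}" "j \<in> {0, 1, 2}" using that by auto
    then have "v i = v j \<longleftrightarrow> i = j" using neq by (auto simp: v_def)
    then show ?thesis using ghost_path_orthogonal[OF vq vq] by auto
  qed
  have unit: "m i j * m k l = (if j = k then m i l else 0)" if "i < 3" "j < 3" "k < 3" "l < 3" for i j k l
  proof -
    have "m i j * m k l =
        path_el (v i) (q i) * (ghost_el (v j) (q j) * path_el (v k) (q k)) * ghost_el (v l) (q l)"
      by (simp add: m_def mult.assoc)
    then show ?thesis using orth[OF that(2,3)] path_V[OF vq] by (simp add: m_def)
  qed
  have m_alg: "m i j \<in> alg" for i j
    unfolding m_def by (intro alg_mult path_in_alg[OF vq] ghost_in_alg[OF vq])
  have "m 0 2 = path_el w d"
    using path_V[OF d(1)] by (simp add: m_def v_def q_def)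
  then have mJ: "m i j \<in> J" if "i < 3" "j < 3" "i \<noteq> j" for i j
    using matrix_units_in_lie_ideal[of m J i j] unit m_alg J(1,3) dJ that by simp
  define B where "B = (\<lambda>(i, j). m i j) ` ({..<3} \<times> {..<3})"
  define R where "R = (\<lambda>(i, j). m i j) ` {(i, j). i < 3 \<and> j < 3 \<and> i \<noteq> j}"
  have BI: "m i j \<in> B" if "i < 3" "j < 3" for i j using that by (force simp: B_def)
  have RI: "m i j \<in> R" if "i < 3" "j < 3" "i \<noteq> j" for i j using that by (force simp: R_def)
  have m_nz: "m i j \<noteq> 0" if "i < 3" "j < 3" for i j
  proof
    assume "m i j = 0"
    \<comment> \<open>Multiplying on the two sides collapses \<open>m i j\<close> to the nonzero
      idempotent \<open>V w2\<close>.\<close>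
    then have "ghost_el (v i) (q i) * (m i j) * path_el (v j) (q j) = 0" by simp
    moreover have "ghost_el (v i) (q i) * (m i j) * path_el (v j) (q j) =
        (ghost_el (v i) (q i) * path_el (v i) (q i)) * (ghost_el (v j) (q j) * path_el (v j) (q j))"
      by (simp add: m_def mult.assoc)
    ultimately show False using orth that V_V[OF w2 w2] V_nonzero[OF w2] by auto
  qed
  show ?thesis
  proof (rule exI[of _ B], rule exI[of _ R], intro conjI ballI)
    show "finite B" by (simp add: B_def)
    show "B \<subseteq> alg" using m_alg by (auto simp: B_def)
    show "x * y \<in> span B" if "x \<in> B" "y \<in> B" for x y
    proof -
      from that obtain i j k l where "x = m i j" "y = m k l" "i < 3" "j < 3" "k < 3" "l < 3"
        by (auto simp: B_def)
      then show ?thesis using unit[of i j k l] BI[of i l] by (auto simp: span_zero intro: span_base)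
    qed
    show "R \<subseteq> J \<inter> span B" using mJ BI by (auto simp: R_def intro: span_base)
    show "R \<noteq> {}" using RI[of 0 1] by auto
    show "0 \<notin> R" using m_nz by (auto simp: R_def)
    fix x assume "x \<in> R"
    then obtain i j where ij: "x = m i j" "i < 3" "j < 3" "i \<noteq> j" by (auto simp: R_def)
    obtain k :: nat where k: "k < 3" "k \<noteq> i" "k \<noteq> j"
    proof -
      have "card {i, j} < card {..<3::nat}" using ij by simp
      then have "\<not> {..<3::nat} \<subseteq> {i, j}" by (meson card_mono finite.intros not_less)
      then show ?thesis using that by blast
    qed
    have "m i k * m k j - m k j * m i k = m i j" using ij k by (simp add: unit)
    then show "\<exists>y\<in>R. \<exists>z\<in>R. x = y * z - z * y" using RI ij k by metis
  qed
qed

end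


section \<open>Transporting Lie algebras to types\<close>

text \<open>
  The bijection \<open>\<theta>\<close> transports the record \<open>L\<close> to a subspace \<open>A\<close> of a type, where the operations
  are those of type classes and linear algebra is that of \<^locale>\<open>vector_space\<close>.
\<close>

locale linear_model = vector_space scale
  for scale :: "'k::field \<Rightarrow> 'r::ab_group_add \<Rightarrow> 'r" (infixr \<open>*s\<close> 75) +
  fixes A :: "'r set" and L :: "('k, 'b) module" and \<theta> :: "'r \<Rightarrow> 'b"
  assumes subspace_A: "subspace A"
    and bij: "bij_betw \<theta> A (carrier L)"
    and \<theta>_add: "\<lbrakk>a \<in> A; b \<in> A\<rbrakk> \<Longrightarrow> \<theta> a \<oplus>\<^bsub>L\<^esub> \<theta> b = \<theta> (a + b)"
    and \<theta>_smult: "a \<in> A \<Longrightarrow> c \<odot>\<^bsub>L\<^esub> \<theta> a = \<theta> (c *s a)"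
    and \<theta>_zero: "\<zero>\<^bsub>L\<^esub> = \<theta> 0"
begin

lemma carrier_L: "carrier L = \<theta> ` A"
  using bij by (simp add: bij_betw_def)

lemma \<theta>_inj: "\<lbrakk>a \<in> A; b \<in> A\<rbrakk> \<Longrightarrow> \<theta> a = \<theta> b \<longleftrightarrow> a = b"
  using bij by (auto simp: bij_betw_def inj_on_def)

lemma vectorspace_L: "vectorspace class_ring L"
proof (intro vectorspace.intro class_field module_criteria)
  show "\<forall>v\<in>carrier L. \<exists>neg_v\<in>carrier L. v \<oplus>\<^bsub>L\<^esub> neg_v = \<zero>\<^bsub>L\<^esub>"
  proof
    fix v assume "v \<in> carrier L"
    then obtain a where a: "a \<in> A" "v = \<theta> a" by (auto simp: carrier_L)
    then have "v \<oplus>\<^bsub>L\<^esub> \<theta> (- a) = \<zero>\<^bsub>L\<^esub>" "\<theta> (- a) \<in> carrier L"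
      using subspace_neg[OF subspace_A] by (auto simp: carrier_L \<theta>_add \<theta>_zero)
    then show "\<exists>neg_v\<in>carrier L. v \<oplus>\<^bsub>L\<^esub> neg_v = \<zero>\<^bsub>L\<^esub>" by blast
  qed
qed (use subspace_A in \<open>auto simp: carrier_L \<theta>_add \<theta>_smult \<theta>_zero subspace_0 subspace_add subspace_scale
    scale_right_distrib scale_left_distrib add_ac class_cring.cring_axioms\<close>)

text \<open>\<open>finite_dimensional\<close> refers to the record with a smaller carrier, so
  results about whole carriers reach subalgebras through this restriction.\<close>

lemma restrict:
  assumes "W \<subseteq> A" "subspace W"
  shows "linear_model (*s) W (L\<lparr>carrier := \<theta> ` W\<rparr>) \<theta>"
proof (unfold_locales)
  show "bij_betw \<theta> W (carrier (L\<lparr>carrier := \<theta> ` W\<rparr>))"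
    using bij_betw_subset[OF bij assms(1)] by simp
qed (use assms \<theta>_add \<theta>_smult \<theta>_zero in \<open>auto simp: subset_iff\<close>)

lemma submodule_image:
  assumes "W \<subseteq> A" "subspace W"
  shows "LinearCombinations.submodule class_ring (\<theta> ` W) L"
proof (rule LinearCombinations.submodule.intro)
  interpret VL: vectorspace class_ring L by (rule vectorspace_L)
  show "Module.module class_ring L" by (rule VL.module_axioms)
qed (use assms in \<open>auto simp: carrier_L subset_iff \<theta>_add \<theta>_smult \<theta>_zero subspace_0 subspace_add subspace_scale
    intro!: imageI\<close>)

lemma subspace_image:
  assumes "W \<subseteq> A" "subspace W"
  shows "VectorSpace.subspace class_ring (\<theta> ` W) L"
  by (intro VectorSpace.subspace.intro vectorspace_L submodule_image assms)

lemma subspace_preimage: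
  assumes "VectorSpace.subspace class_ring U L"
  obtains W where "W \<subseteq> A" "subspace W" "U = \<theta> ` W"
proof
  interpret U: LinearCombinations.submodule class_ring U L
    using assms by (simp add: VectorSpace.subspace_def)
  let ?W = "{a \<in> A. \<theta> a \<in> U}"
  show "subspace ?W"
  proof (rule subspaceI)
    show "0 \<in> ?W" using U.zero_closed subspace_0[OF subspace_A] by (simp add: \<theta>_zero)
    show "x + y \<in> ?W" if "x \<in> ?W" "y \<in> ?W" for x y
      using that subspace_add[OF subspace_A] by (simp add: \<theta>_add[symmetric])
    show "c *s x \<in> ?W" if "x \<in> ?W" for c x
      using that subspace_scale[OF subspace_A] by (simp add: \<theta>_smult[symmetric])
  qed
  show "U = \<theta> ` ?W" using U.subset by (auto simp: carrier_L)
qed auto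

lemma span_image:
  assumes "B \<subseteq> A"
  shows "LinearCombinations.module.span class_ring L (\<theta> ` B) = \<theta> ` span B"
proof
  interpret VL: vectorspace class_ring L by (rule vectorspace_L)
  have BA: "span B \<subseteq> A" using assms subspace_A by (rule span_minimal)
  show "LinearCombinations.module.span class_ring L (\<theta> ` B) \<subseteq> \<theta> ` span B"
    by (rule VL.span_is_subset[OF image_mono[OF span_superset] submodule_image[OF BA subspace_span]])
  have BL: "\<theta> ` B \<subseteq> carrier L" using assms by (auto simp: carrier_L)
  interpret S: LinearCombinations.submodule class_ring "LinearCombinations.module.span class_ring L (\<theta> ` B)" L
    by (rule VL.span_is_submodule[OF BL])
  have "a \<in> A \<and> \<theta> a \<in> LinearCombinations.module.span class_ring L (\<theta> ` B)" if "a \<in> span B" for a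
    using that
  proof (induction rule: span_induct_alt)
    case base
    then show ?case using S.zero_closed subspace_0[OF subspace_A] by (simp add: \<theta>_zero)
  next
    case (step c x y)
    have x: "\<theta> x \<in> LinearCombinations.module.span class_ring L (\<theta> ` B)" using VL.in_own_span[OF BL] step by blast
    have mem: "x \<in> A" "y \<in> A" using step assms by auto
    then have "\<theta> (c *s x + y) = (c \<odot>\<^bsub>L\<^esub> \<theta> x) \<oplus>\<^bsub>L\<^esub> \<theta> y"
      using subspace_scale[OF subspace_A] by (simp add: \<theta>_add \<theta>_smult)
    moreover have "c *s x + y \<in> A"
      using mem subspace_add[OF subspace_A] subspace_scale[OF subspace_A] by blast
    ultimately show ?case using S.m_closed[OF S.smult_closed[OF _ x]] step by simp
  qed
  then show "\<theta> ` span B \<subseteq> LinearCombinations.module.span class_ring L (\<theta> ` B)" by blast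
qed

lemma fin_dim_iff:
  "vectorspace.fin_dim class_ring L \<longleftrightarrow> (\<exists>B. finite B \<and> B \<subseteq> A \<and> span B = A)"
proof -
  interpret VL: vectorspace class_ring L by (rule vectorspace_L)
  show ?thesis
  proof
    assume "VL.fin_dim"
    then obtain C where C: "finite C" "C \<subseteq> carrier L" "LinearCombinations.module.span class_ring L C = carrier L"
      by (auto simp: VL.fin_dim_def)
    from C(1,2) obtain B where B: "B \<subseteq> A" "finite B" "C = \<theta> ` B"
      unfolding carrier_L by (meson finite_subset_image)
    have "span B \<subseteq> A" using B(1) subspace_A by (rule span_minimal)
    moreover have "\<theta> ` span B = \<theta> ` A" using C(3) span_image[OF B(1)] B(3) by (simp add: carrier_L)
    ultimately have "span B = A"
      using bij unfolding bij_betw_def by (metis inj_on_image_eq_iff order_refl)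
    with B show "\<exists>B. finite B \<and> B \<subseteq> A \<and> span B = A" by blast
  next
    assume "\<exists>B. finite B \<and> B \<subseteq> A \<and> span B = A"
    then obtain B where B: "finite B" "B \<subseteq> A" "span B = A" by blast
    then show "VL.fin_dim"
      unfolding VL.fin_dim_def using span_image[OF B(2)]
      by (intro exI[of _ "\<theta> ` B"]) (auto simp: carrier_L)
  qed
qed

lemma finite_dimensional_image:
  assumes "W \<subseteq> A" "subspace W"
  shows "finite_dimensional class_ring L (\<theta> ` W) \<longleftrightarrow> (\<exists>B. finite B \<and> span B = W)"
proof -
  interpret W: linear_model "(*s)" W "L\<lparr>carrier := \<theta> ` W\<rparr>" \<theta>
    using assms by (rule restrict)
  show ?thesis
    unfolding finite_dimensional_def W.fin_dim_iff using span_superset by blast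
qed

lemma subspace_finite_span:
  assumes "subspace W" "W \<subseteq> span B" "finite B"
  shows "\<exists>C. finite C \<and> span C = W"
proof -
  obtain C where C: "C \<subseteq> W" "independent C" "W \<subseteq> span C"
    using maximal_independent_subset by blast
  then have "finite C" using independent_span_bound[OF assms(3) C(2)] assms(2) by blast
  moreover have "span C = W" using C assms(1) by (simp add: span_minimal subset_antisym)
  ultimately show ?thesis by blast
qed

lemma \<theta>_minus:
  assumes "a \<in> A" "b \<in> A"
  shows "\<theta> a \<ominus>\<^bsub>L\<^esub> \<theta> b = \<theta> (a - b)"
proof -
  interpret VL: vectorspace class_ring L by (rule vectorspace_L)
  have b: "- b \<in> A" using assms(2) by (rule subspace_neg[OF subspace_A])
  have "\<ominus>\<^bsub>L\<^esub> \<theta> b = \<theta> (- b)"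
    by (rule VL.minus_equality) (use assms b in \<open>auto simp: carrier_L \<theta>_add \<theta>_zero\<close>)
  then show ?thesis using assms(1) b by (simp add: a_minus_def \<theta>_add)
qed

end

section \<open>Commutator Lie algebras\<close>

text \<open>Only the bracket is carried over to \<open>L\<close>; the associative product stays
  available on the side of \<open>A\<close>.\<close>

locale lie_model = linear_model scale A L \<theta>
  for scale :: "'k::field \<Rightarrow> 'r::ring \<Rightarrow> 'r" (infixr \<open>*s\<close> 75)
    and A and L :: "('k, 'b) module" and \<theta> +
  assumes scale_mult_left: "(c *s x) * y = c *s (x * y)"
    and scale_mult_right: "x * (c *s y) = c *s (x * y)"
    and A_mult: "\<lbrakk>a \<in> A; b \<in> A\<rbrakk> \<Longrightarrow> a * b \<in> A"
    and \<theta>_bracket: "\<lbrakk>a \<in> A; b \<in> A\<rbrakk> \<Longrightarrow> \<theta> a \<otimes>\<^bsub>L\<^esub> \<theta> b = \<theta> (a * b - b * a)"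
begin

lemma A_bracket: "\<lbrakk>a \<in> A; b \<in> A\<rbrakk> \<Longrightarrow> a * b - b * a \<in> A"
  by (intro subspace_diff subspace_A A_mult)

lemma lie_algebra_L: "lie_algebra class_ring L"
proof -
  interpret VL: vectorspace class_ring L by (rule vectorspace_L)
  note simps = \<theta>_add \<theta>_smult \<theta>_zero \<theta>_bracket A_bracket subspace_add[OF subspace_A]
    subspace_scale[OF subspace_A] scale_mult_left scale_mult_right scale_right_diff_distrib
  show ?thesis
  proof unfold_locales
    fix x y z assume "x \<in> carrier L" "y \<in> carrier L" "z \<in> carrier L"
    then obtain a b c where "x = \<theta> a" "y = \<theta> b" "z = \<theta> c" "a \<in> A" "b \<in> A" "c \<in> A"
      by (auto simp: carrier_L)
    then show "x \<otimes>\<^bsub>L\<^esub> (y \<otimes>\<^bsub>L\<^esub> z) \<oplus>\<^bsub>L\<^esub> y \<otimes>\<^bsub>L\<^esub> (z \<otimes>\<^bsub>L\<^esub> x) \<oplus>\<^bsub>L\<^esub> z \<otimes>\<^bsub>L\<^esub> (x \<otimes>\<^bsub>L\<^esub> y) = \<zero>\<^bsub>L\<^esub>"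
      by (simp add: simps) (simp add: algebra_simps)
  qed (auto simp: carrier_L simps algebra_simps)
qed

lemma lie_subalgebra_image:
  assumes "W \<subseteq> A" "subspace W" "\<And>x y. x \<in> W \<Longrightarrow> y \<in> W \<Longrightarrow> x * y - y * x \<in> W"
  shows "lie_subalgebra class_ring L (\<theta> ` W)"
  using assms subspace_image[OF assms(1,2)]
  by (auto simp: lie_subalgebra_def \<theta>_bracket subset_iff)

text \<open>The image of \<open>R\<close> lies in every derived term by induction, while a nonzero
  element of it would have to vanish in a solvable algebra.\<close>

lemma not_solvable:
  assumes "R \<subseteq> A" "\<theta> ` R \<subseteq> U" "R \<noteq> {}" "0 \<notin> R"
    and comm: "\<And>x. x \<in> R \<Longrightarrow> \<exists>y\<in>R. \<exists>z\<in>R. x = y * z - z * y"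
  shows "\<not> solvable class_ring L U"
proof -
  interpret VL: vectorspace class_ring L by (rule vectorspace_L)
  have "\<theta> ` R \<subseteq> derived_series class_ring L U n" for n
  proof (induction n)
    case (Suc n)
    let ?S = "{x \<otimes>\<^bsub>L\<^esub> y | x y. x \<in> derived_series class_ring L U n \<and> y \<in> derived_series class_ring L U n}"
    have "\<theta> ` R \<subseteq> ?S"
    proof
      fix w assume "w \<in> \<theta> ` R"
      then obtain x where x: "x \<in> R" "w = \<theta> x" by blast
      then obtain y z where yz: "y \<in> R" "z \<in> R" "x = y * z - z * y" using comm by blast
      then have "w = \<theta> y \<otimes>\<^bsub>L\<^esub> \<theta> z" using x assms(1) by (auto simp: \<theta>_bracket subset_iff)
      then show "w \<in> ?S" using yz Suc by blast
    qed
    then have "LinearCombinations.module.span class_ring L (\<theta> ` R) \<subseteq> LinearCombinations.module.span class_ring L ?S"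
      by (rule VL.span_is_monotone)
    moreover have "\<theta> ` R \<subseteq> LinearCombinations.module.span class_ring L (\<theta> ` R)"
      using assms(1) by (intro VL.in_own_span) (auto simp: carrier_L)
    ultimately show ?case by simp
  qed (use assms in simp)
  moreover obtain r where r: "r \<in> R" using assms(3) by blast
  moreover have "\<theta> r \<noteq> \<zero>\<^bsub>L\<^esub>"
    using r assms(1,4) \<theta>_inj[of r 0] subspace_0[OF subspace_A] by (auto simp: \<theta>_zero subset_iff)
  ultimately show ?thesis unfolding solvable_def by blast
qed

lemma locally_finite_L:
  assumes "\<And>X. finite X \<Longrightarrow> X \<subseteq> A \<Longrightarrow>
    \<exists>B. finite B \<and> B \<subseteq> A \<and> X \<subseteq> span B \<and> (\<forall>x\<in>span B. \<forall>y\<in>span B. x * y \<in> span B)"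
  shows "locally_finite class_ring L"
  unfolding locally_finite_def
proof (intro allI impI)
  fix Y assume "finite Y \<and> Y \<subseteq> carrier L"
  then obtain X where X: "X \<subseteq> A" "finite X" "Y = \<theta> ` X"
    unfolding carrier_L by (meson finite_subset_image)
  obtain B where B: "finite B" "B \<subseteq> A" "X \<subseteq> span B" "\<forall>x\<in>span B. \<forall>y\<in>span B. x * y \<in> span B"
    using assms[OF X(2,1)] by blast
  have BA: "span B \<subseteq> A" using B(2) subspace_A by (rule span_minimal)
  have "lie_subalgebra class_ring L (\<theta> ` span B)"
    using BA B(4) by (intro lie_subalgebra_image) (auto intro: span_diff)
  moreover have "finite_dimensional class_ring L (\<theta> ` span B)"
    using finite_dimensional_image[OF BA] B(1) by blast
  ultimately show "\<exists>U. lie_subalgebra class_ring L U \<and> finite_dimensional class_ring L U \<and> Y \<subseteq> U"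
    using B(3) X(3) by blast
qed

text \<open>The hypothesis leaves the zero ideal as the only locally solvable ideal. It is therefore
  the unique maximal one, and the description defining the radical denotes it.\<close>

lemma semisimple_L:
  assumes "\<And>J x. subspace J \<Longrightarrow> J \<subseteq> A \<Longrightarrow> (\<And>a x. a \<in> A \<Longrightarrow> x \<in> J \<Longrightarrow> a * x - x * a \<in> J) \<Longrightarrow>
      x \<in> J \<Longrightarrow> x \<noteq> 0 \<Longrightarrow>
    \<exists>B R. finite B \<and> B \<subseteq> A \<and> (\<forall>x\<in>span B. \<forall>y\<in>span B. x * y \<in> span B) \<and> R \<subseteq> J \<inter> span B \<and>
      R \<noteq> {} \<and> 0 \<notin> R \<and> (\<forall>x\<in>R. \<exists>y\<in>R. \<exists>z\<in>R. x = y * z - z * y)"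
  shows "semisimple class_ring L"
proof -
  let ?O = "{\<zero>\<^bsub>L\<^esub>}"
  have O: "?O = \<theta> ` {0}" by (simp add: \<theta>_zero)
  have 0: "0 \<in> A" by (rule subspace_0[OF subspace_A])
  have ideal0: "lie_ideal class_ring L ?O"
    unfolding lie_ideal_def O using subspace_image[of "{0}"] 0 by (auto simp: carrier_L \<theta>_bracket)
  have solv0: "locally_solvable class_ring L ?O"
    unfolding locally_solvable_def
  proof (intro allI impI)
    fix W assume W: "W \<subseteq> ?O \<and> lie_subalgebra class_ring L W \<and> finite_dimensional class_ring L W"
    then obtain W' where "subspace W'" "W = \<theta> ` W'"
      unfolding lie_subalgebra_def using subspace_preimage by metis
    then have "\<theta> 0 \<in> W" using subspace_0 by blast
    with W have "W = ?O" by auto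
    then have "derived_series class_ring L W 0 = ?O" by simp
    then show "solvable class_ring L W" unfolding solvable_def by blast
  qed
  have triv: "I = ?O" if I: "lie_ideal class_ring L I" "locally_solvable class_ring L I" for I
  proof -
    have "VectorSpace.subspace class_ring I L" using I(1) by (simp add: lie_ideal_def)
    then obtain J where J: "J \<subseteq> A" "subspace J" "I = \<theta> ` J" by (rule subspace_preimage)
    have J_ideal: "a * x - x * a \<in> J" if "a \<in> A" "x \<in> J" for a x
    proof -
      have "\<theta> a \<otimes>\<^bsub>L\<^esub> \<theta> x \<in> I" using I(1) J(3) that unfolding lie_ideal_def carrier_L by blast
      then have "\<theta> (a * x - x * a) \<in> \<theta> ` J" using J that by (auto simp: \<theta>_bracket subset_iff)
      then show ?thesis using \<theta>_inj A_bracket that J(1) by (metis image_iff subsetD)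
    qed
    have "x = 0" if x: "x \<in> J" for x
    proof (rule ccontr)
      assume "x \<noteq> 0"
      then obtain B R where BR: "finite B" "B \<subseteq> A" "\<forall>x\<in>span B. \<forall>y\<in>span B. x * y \<in> span B"
        "R \<subseteq> J \<inter> span B" "R \<noteq> {}" "0 \<notin> R" "\<forall>x\<in>R. \<exists>y\<in>R. \<exists>z\<in>R. x = y * z - z * y"
        using assms[OF J(2,1) J_ideal x] by blast
      \<comment> \<open>Meeting the ideal with a finite-dimensional subalgebra gives a
        finite-dimensional Lie subalgebra that still contains \<open>R\<close>.\<close>
      let ?W = "J \<inter> span B"
      have W: "?W \<subseteq> A" "subspace ?W" using J by (auto intro: subspace_inter)
      have "lie_subalgebra class_ring L (\<theta> ` ?W)"
        using W BR(3) J(1) by (intro lie_subalgebra_image) (auto intro: J_ideal span_diff)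
      moreover have "finite_dimensional class_ring L (\<theta> ` ?W)"
        using finite_dimensional_image[OF W] subspace_finite_span[OF W(2) _ BR(1)] by blast
      ultimately have "solvable class_ring L (\<theta> ` ?W)"
        using I(2)[unfolded locally_solvable_def, rule_format, of "\<theta> ` ?W"] J(3) by auto
      moreover have "\<not> solvable class_ring L (\<theta> ` ?W)"
        using BR W by (intro not_solvable[of R]) auto
      ultimately show False by blast
    qed
    then have "J = {0}" using subspace_0[OF J(2)] by blast
    then show ?thesis using J(3) O by simp
  qed
  have "locally_solvable_radical class_ring L = ?O"
    unfolding locally_solvable_radical_def
    by (rule the_equality) (use ideal0 solv0 triv in blast)+
  then show ?thesis by (simp add: semisimple_def)
qed

end


section \<open>Quotients of monoid algebras\<close>

abbreviation mscale :: "'k::field \<Rightarrow> ('a::monoid_add \<Rightarrow>\<^sub>0 'k) \<Rightarrow> 'a \<Rightarrow>\<^sub>0 'k" where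
  "mscale c x \<equiv> Poly_Mapping.single 0 c * x"

lemma vector_space_mscale: "vector_space (mscale :: 'k::field \<Rightarrow> ('a::monoid_add \<Rightarrow>\<^sub>0 'k) \<Rightarrow> _)"
  by standard (simp_all add: distrib_left distrib_right single_add mult.assoc[symmetric] mult_single)

lemma sum_single_lookup:
  fixes x :: "'a \<Rightarrow>\<^sub>0 'b::comm_monoid_add"
  shows "(\<Sum>k\<in>Poly_Mapping.keys x. Poly_Mapping.single k (Poly_Mapping.lookup x k)) = x"
  by (rule poly_mapping_eqI)
    (auto simp: lookup_sum lookup_single when_def in_keys_iff sum.delta)

lemma single_induct [case_names zero single add]:
  fixes x :: "'a \<Rightarrow>\<^sub>0 'b::comm_monoid_add"
  assumes "P 0" "\<And>k c. k \<in> Poly_Mapping.keys x \<Longrightarrow> P (Poly_Mapping.single k c)"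
    and "\<And>x y. P x \<Longrightarrow> P y \<Longrightarrow> P (x + y)"
  shows "P x"
proof -
  have "P (\<Sum>k\<in>K. Poly_Mapping.single k (Poly_Mapping.lookup x k))"
    if "finite K" "K \<subseteq> Poly_Mapping.keys x" for K
    using that by (induction rule: finite_induct) (auto intro: assms)
  from this[of "Poly_Mapping.keys x"] show ?thesis by (simp add: sum_single_lookup)
qed

text \<open>Scalars are central: 0 is neutral on both sides in the monoid and the coefficients
  commute, although the monoid need not be commutative.\<close>

lemma mult_mscale: "x * mscale c y = mscale c (x * y)"
  for x y :: "'a::monoid_add \<Rightarrow>\<^sub>0 'k::field"
proof -
  have "x * Poly_Mapping.single 0 c = Poly_Mapping.single 0 c * x"
    by (induction x rule: single_induct) (auto simp: mult_single mult.commute distrib_left distrib_right)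
  then show ?thesis by (metis mult.assoc)
qed

section \<open>Realising a quotient by linear endomorphisms\<close>

text \<open>A quotient by an ideal that depends on the graph is a set of cosets and not a type.
  Linear endomorphisms form a type carrying the class \<open>ring\<close>, with composition as
  product.\<close>

typedef (overloaded) ('a, 'k) lin_endo =
  "{f :: ('a::monoid_add \<Rightarrow>\<^sub>0 'k::field) \<Rightarrow> 'a \<Rightarrow>\<^sub>0 'k.
     (\<forall>x y. f (x + y) = f x + f y) \<and> (\<forall>c x. f (mscale c x) = mscale c (f x))}"
  morphisms app Lin
  by (rule exI[of _ "\<lambda>_. 0"]) simp

setup_lifting type_definition_lin_endo

instantiation lin_endo :: (monoid_add, field) ring
begin

lift_definition zero_lin_endo :: "('a, 'b) lin_endo" is "\<lambda>_. 0" by simp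

lift_definition plus_lin_endo :: "('a, 'b) lin_endo \<Rightarrow> ('a, 'b) lin_endo \<Rightarrow> ('a, 'b) lin_endo"
  is "\<lambda>f g x. f x + g x" by (simp add: distrib_left add_ac)

lift_definition minus_lin_endo :: "('a, 'b) lin_endo \<Rightarrow> ('a, 'b) lin_endo \<Rightarrow> ('a, 'b) lin_endo"
  is "\<lambda>f g x. f x - g x" by (simp add: right_diff_distrib)

lift_definition uminus_lin_endo :: "('a, 'b) lin_endo \<Rightarrow> ('a, 'b) lin_endo"
  is "\<lambda>f x. - f x" by simp

lift_definition times_lin_endo :: "('a, 'b) lin_endo \<Rightarrow> ('a, 'b) lin_endo \<Rightarrow> ('a, 'b) lin_endo"
  is "\<lambda>f g x. f (g x)" by simp

instance
proof
  fix a b c :: "('a, 'b) lin_endo"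
  show "a + b + c = a + (b + c)" by transfer (simp add: add.assoc)
  show "a + b = b + a" by transfer (simp add: add.commute)
  show "0 + a = a" by transfer simp
  show "- a + a = 0" by transfer simp
  show "a - b = a + - b" by transfer simp
  show "a * b * c = a * (b * c)" by transfer simp
  show "(a + b) * c = a * c + b * c" by transfer simp
  show "a * (b + c) = a * b + a * c" by transfer simp
qed

end

lift_definition escale :: "'k::field \<Rightarrow> ('a::monoid_add, 'k) lin_endo \<Rightarrow> ('a, 'k) lin_endo"
  is "\<lambda>c f x. mscale c (f x)"
  using mult_mscale[of "Poly_Mapping.single 0 _"] by (auto simp: distrib_left)

lemma vector_space_escale: "vector_space (escale :: 'k::field \<Rightarrow> ('a::monoid_add, 'k) lin_endo \<Rightarrow> _)"
proof
  fix a b :: 'k and x y :: "('a, 'k) lin_endo"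
  interpret M: vector_space "mscale :: 'k \<Rightarrow> ('a \<Rightarrow>\<^sub>0 'k) \<Rightarrow> _" by (rule vector_space_mscale)
  show "escale a (x + y) = escale a x + escale a y" by transfer (simp add: distrib_left)
  show "escale (a + b) x = escale a x + escale b x" by transfer (simp add: M.scale_left_distrib)
  show "escale a (escale b x) = escale (a * b) x" by transfer (simp only: M.scale_scale)
  show "escale 1 x = x" by transfer simp
qed

lemma escale_mult: "escale c x * y = escale c (x * y)" "x * escale c y = escale c (x * y)"
  by (transfer, simp)+

text \<open>
  Let \<open>\<pi>\<close> be a linear projection with kernel \<open>I\<close>. Then \<open>x \<mapsto> (y \<mapsto> \<pi> (x * y))\<close> is multiplicative
  and vanishes on \<open>x\<close> iff \<open>x \<in> I\<close>; it realises the quotient by \<open>I\<close> inside a type of sort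
  \<^class>\<open>ring\<close>.
\<close>

lemma quotient_representation:
  fixes I :: "('a::monoid_add \<Rightarrow>\<^sub>0 'k::field) set"
  assumes zero: "0 \<in> I" and add: "\<And>x y. x \<in> I \<Longrightarrow> y \<in> I \<Longrightarrow> x + y \<in> I"
    and left: "\<And>a x. x \<in> I \<Longrightarrow> a * x \<in> I" and right: "\<And>a x. x \<in> I \<Longrightarrow> x * a \<in> I"
  obtains \<phi> :: "('a \<Rightarrow>\<^sub>0 'k) \<Rightarrow> ('a, 'k) lin_endo"
  where "\<And>x y. \<phi> (x + y) = \<phi> x + \<phi> y" "\<And>x y. \<phi> (x * y) = \<phi> x * \<phi> y"
    "\<And>c x. \<phi> (mscale c x) = escale c (\<phi> x)" "\<And>x. \<phi> x = 0 \<longleftrightarrow> x \<in> I"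
proof -
  interpret M: vector_space "mscale :: 'k \<Rightarrow> ('a \<Rightarrow>\<^sub>0 'k) \<Rightarrow> _" by (rule vector_space_mscale)
  interpret P: vector_space_pair "mscale :: 'k \<Rightarrow> ('a \<Rightarrow>\<^sub>0 'k) \<Rightarrow> _" "mscale :: 'k \<Rightarrow> ('a \<Rightarrow>\<^sub>0 'k) \<Rightarrow> _"
    by unfold_locales
  have sub: "M.subspace I" using zero add left by (auto intro: M.subspaceI)
  \<comment> \<open>The projection kills a basis \<open>B\<close> of \<open>I\<close> and fixes the
    vectors that extend \<open>B\<close> to a basis of the whole space.\<close>
  obtain B where B: "B \<subseteq> I" "M.independent B" "I \<subseteq> M.span B"
    using M.maximal_independent_subset[of I] by blast
  let ?C = "M.extend_basis B"
  have C: "B \<subseteq> ?C" "M.independent ?C" "M.span ?C = UNIV"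
    using M.extend_basis_superset[OF B(2)] M.independent_extend_basis[OF B(2)] M.span_extend_basis[OF B(2)]
    by auto
  obtain \<pi> where \<pi>: "Vector_Spaces.linear mscale mscale \<pi>" "\<And>x. x \<in> ?C \<Longrightarrow> \<pi> x = (if x \<in> B then 0 else x)"
    using P.linear_independent_extend[OF C(2), of "\<lambda>x. if x \<in> B then 0 else x"] by blast
  interpret \<pi>: Vector_Spaces.linear mscale mscale \<pi> by (rule \<pi>(1))
  have \<pi>_zero: "\<pi> x = 0" if "x \<in> I" for x
  proof (rule \<pi>.eq_0_on_span[of B])
    show "\<pi> b = 0" if "b \<in> B" for b using \<pi>(2)[of b] C(1) that by auto
    show "x \<in> M.span B" using B(3) that by blast
  qed
  have \<pi>_diff: "\<pi> x - x \<in> I" for x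
  proof -
    have "x \<in> M.span ?C" using C(3) by simp
    then show ?thesis
    proof (induction rule: M.span_induct_alt)
      case base
      then show ?case using zero by simp
    next
      case (step c x y)
      have "\<pi> x - x \<in> I"
        using \<pi>(2)[OF step(1)] B(1) zero M.subspace_neg[OF sub] by auto
      then have "mscale c (\<pi> x - x) + (\<pi> y - y) \<in> I" using add left step(2) by blast
      then show ?case by (simp add: \<pi>.add \<pi>.scale algebra_simps)
    qed
  qed
  have \<pi>_iff: "\<pi> x = 0 \<longleftrightarrow> x \<in> I" for x
    using \<pi>_zero \<pi>_diff[of x] M.subspace_neg[OF sub, of "- x"] by auto
  define \<phi> where "\<phi> x = Lin (\<lambda>y. \<pi> (x * y))" for x
  have app: "app (\<phi> x) = (\<lambda>y. \<pi> (x * y))" for x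
    unfolding \<phi>_def by (rule Lin_inverse) (simp add: distrib_left mult_mscale \<pi>.add \<pi>.scale)
  show thesis
  proof
    fix x y and c :: 'k
    show "\<phi> (x + y) = \<phi> x + \<phi> y"
      by (simp add: app_inject[symmetric] app plus_lin_endo.rep_eq distrib_right \<pi>.add)
    \<comment> \<open>Applying \<open>\<pi>\<close> changes \<open>y * z\<close> by an element of
      \<open>I\<close>, and left multiplication by \<open>x\<close> keeps that error in
      \<open>I\<close>.\<close>
    have "\<pi> (x * \<pi> (y * z)) = \<pi> (x * y * z)" for z
    proof -
      have "\<pi> (x * (\<pi> (y * z) - y * z)) = 0" by (intro \<pi>_zero left \<pi>_diff)
      then show ?thesis by (simp add: right_diff_distrib \<pi>.diff mult.assoc)
    qed
    then show "\<phi> (x * y) = \<phi> x * \<phi> y"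
      by (simp add: app_inject[symmetric] app times_lin_endo.rep_eq)
    show "\<phi> (mscale c x) = escale c (\<phi> x)"
      by (simp add: app_inject[symmetric] app escale.rep_eq mult.assoc \<pi>.scale)
    have "\<phi> x = 0 \<longleftrightarrow> (\<forall>y. x * y \<in> I)"
      by (simp add: app_inject[symmetric] app zero_lin_endo.rep_eq fun_eq_iff \<pi>_iff)
    \<comment> \<open>The test element is \<open>y = 1\<close>. This is where the unit enters, and
      why the whole monoid algebra is used in place of the non-unital free algebra.\<close>
    also have "\<dots> \<longleftrightarrow> x \<in> I" using right[of x] by (metis mult.right_neutral)
    finally show "\<phi> x = 0 \<longleftrightarrow> x \<in> I" .
  qed
qed


section \<open>Presented algebras\<close>

locale presented_algebra =
  fixes X :: "'g set" and R :: "('g fword \<Rightarrow>\<^sub>0 'k::field) set"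
  assumes relations: "R \<subseteq> carrier (free_algebra X)"
begin

abbreviation F :: "('k, 'g fword \<Rightarrow>\<^sub>0 'k) module" where "F \<equiv> free_algebra X"
abbreviation I where "I \<equiv> ideal_generated F R"

lemma mem_F: "f \<in> carrier F \<longleftrightarrow> (\<forall>w\<in>Poly_Mapping.keys f. letters w \<noteq> [] \<and> set (letters w) \<subseteq> X)"
  by (simp add: free_algebra_def)

lemma F_ops [simp]:
  "\<zero>\<^bsub>F\<^esub> = 0" "x \<oplus>\<^bsub>F\<^esub> y = x + y" "x \<otimes>\<^bsub>F\<^esub> y = x * y" "c \<odot>\<^bsub>F\<^esub> x = mscale c x"
  by (simp_all add: free_algebra_def)

lemma letters_plus [simp]: "letters (u + w) = letters u @ letters w"
  by (simp add: plus_fword_def)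

lemma F_zero [simp]: "0 \<in> carrier F"
  by (simp add: mem_F)

lemma F_add: "x \<in> carrier F \<Longrightarrow> y \<in> carrier F \<Longrightarrow> x + y \<in> carrier F"
  using keys_add[of x y] by (auto simp: mem_F)

lemma F_mult: "x \<in> carrier F \<Longrightarrow> y \<in> carrier F \<Longrightarrow> x * y \<in> carrier F"
  using keys_mult[of x y] by (fastforce simp: mem_F)

lemma F_scale: "x \<in> carrier F \<Longrightarrow> mscale c x \<in> carrier F"
proof -
  have "Poly_Mapping.keys (mscale c x) \<subseteq> Poly_Mapping.keys x"
    using keys_mult[of "Poly_Mapping.single 0 c" x] by (auto split: if_splits)
  then show "x \<in> carrier F \<Longrightarrow> mscale c x \<in> carrier F" by (auto simp: mem_F)
qed

lemma F_diff: "x \<in> carrier F \<Longrightarrow> y \<in> carrier F \<Longrightarrow> x - y \<in> carrier F"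
  using keys_diff[of x y] by (auto simp: mem_F)

lemma I_F: "x \<in> I \<Longrightarrow> x \<in> carrier F"
  by (induction rule: ideal_generated.induct)
    (use relations in \<open>auto intro: F_add F_mult F_scale\<close>)

lemma I_closed:
  "0 \<in> I" "x \<in> I \<Longrightarrow> y \<in> I \<Longrightarrow> x + y \<in> I" "x \<in> I \<Longrightarrow> mscale c x \<in> I"
  "x \<in> I \<Longrightarrow> a \<in> carrier F \<Longrightarrow> a * x \<in> I" "x \<in> I \<Longrightarrow> a \<in> carrier F \<Longrightarrow> x * a \<in> I"
  using ideal_generated.intros[where A = F and R = R] by auto

end

section \<open>The quotient algebra as a linear model\<close>

locale quotient_model = presented_algebra X R
  for X :: "'g set" and R :: "('g fword \<Rightarrow>\<^sub>0 'k::field) set" +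
  fixes \<phi> :: "('g fword \<Rightarrow>\<^sub>0 'k) \<Rightarrow> ('g fword, 'k) lin_endo"
  assumes \<phi>_add: "\<phi> (x + y) = \<phi> x + \<phi> y" and \<phi>_mult: "\<phi> (x * y) = \<phi> x * \<phi> y"
    and \<phi>_scale: "\<phi> (mscale c x) = escale c (\<phi> x)"
    and \<phi>_ker: "x \<in> carrier F \<Longrightarrow> \<phi> x = 0 \<longleftrightarrow> x \<in> I"

text \<open>
  The generators outside \<open>X\<close> are sent to zero, so that the ideal extends to the whole monoid
  algebra.
\<close>

lemma (in presented_algebra) quotient_model_exists: "\<exists>\<phi>. quotient_model X R \<phi>"
proof -
  define N :: "('g fword \<Rightarrow>\<^sub>0 'k) set"
    where "N = {n. \<forall>w\<in>Poly_Mapping.keys n. \<not> set (letters w) \<subseteq> X}"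
  have N_zero: "0 \<in> N" by (simp add: N_def)
  have N_add: "x + y \<in> N" if "x \<in> N" "y \<in> N" for x y
    using keys_add[of x y] that by (auto simp: N_def)
  have N_left: "a * x \<in> N" if "x \<in> N" for a x
    using keys_mult[of a x] that by (fastforce simp: N_def)
  have N_right: "x * a \<in> N" if "x \<in> N" for a x
    using keys_mult[of x a] that by (fastforce simp: N_def)
  define Ih where "Ih = {i + n | i n. i \<in> I \<and> n \<in> N}"
  have IhI: "i + n \<in> Ih" if "i \<in> I" "n \<in> N" for i n using that by (auto simp: Ih_def)
  have Ih_I: "i \<in> Ih" if "i \<in> I" for i using IhI[OF that N_zero] by simp
  have Ih_N: "n \<in> Ih" if "n \<in> N" for n using IhI[OF I_closed(1) that] by simp
  have zero: "0 \<in> Ih" by (rule Ih_I[OF I_closed(1)])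
  have add: "x + y \<in> Ih" if x: "x \<in> Ih" and y: "y \<in> Ih" for x y
  proof -
    obtain i n where 1: "x = i + n" "i \<in> I" "n \<in> N" using x by (auto simp: Ih_def)
    obtain j m where 2: "y = j + m" "j \<in> I" "m \<in> N" using y by (auto simp: Ih_def)
    have "x + y = (i + j) + (n + m)" using 1 2 by (simp add: add_ac)
    then show ?thesis using IhI[OF I_closed(2)[OF 1(2) 2(2)] N_add[OF 1(3) 2(3)]] by simp
  qed
  \<comment> \<open>A word is non-empty over \<open>X\<close>, empty, or contains a foreign letter.
    Multiplication by these three kinds is absorbed by the ideal property of \<open>I\<close>, by
    scaling, and by \<open>N\<close>.\<close>
  have single_cases: "Poly_Mapping.single k c \<in> carrier F \<or> k = 0 \<or> Poly_Mapping.single k c \<in> N" for k c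
    by (cases k) (auto simp: mem_F N_def zero_fword_def)
  have I_left: "a * i \<in> Ih" if i: "i \<in> I" for a i
  proof (induction a rule: single_induct)
    case (single k c)
    from single_cases[of k c] show ?case
      using I_closed(3,4)[OF i] Ih_I Ih_N N_right by auto
  qed (use zero add in \<open>auto simp: distrib_right\<close>)
  have I_right: "i * a \<in> Ih" if i: "i \<in> I" for a i
  proof (induction a rule: single_induct)
    case (single k c)
    have "i * Poly_Mapping.single 0 c = mscale c i"
      using mult_mscale[of i c 1] by simp
    then show ?case
      using single_cases[of k c] I_closed(3,5)[OF i] Ih_I Ih_N N_left by auto
  qed (use zero add in \<open>auto simp: distrib_left\<close>)
  have left: "a * x \<in> Ih" if x: "x \<in> Ih" for a x
    using x I_left add Ih_N N_left by (auto simp: Ih_def[of] distrib_left intro!: add)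
  have right: "x * a \<in> Ih" if x: "x \<in> Ih" for a x
    using x I_right add Ih_N N_right by (auto simp: Ih_def distrib_right intro!: add)
  obtain \<phi> :: "('g fword \<Rightarrow>\<^sub>0 'k) \<Rightarrow> ('g fword, 'k) lin_endo"
    where \<phi>: "\<And>x y. \<phi> (x + y) = \<phi> x + \<phi> y" "\<And>x y. \<phi> (x * y) = \<phi> x * \<phi> y"
      "\<And>c x. \<phi> (mscale c x) = escale c (\<phi> x)" "\<And>x. \<phi> x = 0 \<longleftrightarrow> x \<in> Ih"
    using quotient_representation[of Ih, OF zero add left right] by blast
  have "x \<in> I" if xF: "x \<in> carrier F" and xIh: "x \<in> Ih" for x
  proof -
    obtain i n where x: "x = i + n" "i \<in> I" "n \<in> N" using xIh by (auto simp: Ih_def)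
    then have "n = x - i" by simp
    then have "n \<in> carrier F" using F_diff[OF xF I_F[OF x(2)]] by simp
    \<comment> \<open>The words of \<open>n\<close> would use only letters of \<open>X\<close> and
      also some letter outside it. So extending the ideal creates no new relations in the free
      algebra.\<close>
    then have "Poly_Mapping.keys n = {}" using x(3) by (fastforce simp: mem_F N_def)
    then have "n = 0" by (metis keys_eq_empty)
    then show ?thesis using x by simp
  qed
  then have "\<phi> x = 0 \<longleftrightarrow> x \<in> I" if "x \<in> carrier F" for x
    using \<phi>(4) Ih_I that by blast
  then have "quotient_model X R \<phi>" by unfold_locales (use \<phi>(1-3) in auto)
  then show ?thesis by blast
qed

context quotient_model
begin

text \<open>For \<open>a\<close> in the image of the carrier, the fibre of \<open>\<phi>\<close>
  over \<open>a\<close> is a coset of \<open>I\<close>; thus \<open>\<theta>\<close> leads from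
  endomorphisms back to the quotient record.\<close>

definition \<theta> :: "('g fword, 'k) lin_endo \<Rightarrow> ('g fword \<Rightarrow>\<^sub>0 'k) set" where
  "\<theta> a = {x \<in> carrier F. \<phi> x = a}"

abbreviation Q where "Q \<equiv> quotient_algebra F I"

lemma \<phi>_diff: "\<phi> (x - y) = \<phi> x - \<phi> y"
  using \<phi>_add[of "x - y" y] by (simp add: algebra_simps)

lemma \<phi>_zero: "\<phi> 0 = 0"
  using \<phi>_add[of 0 0] by simp

lemma coset_eq: "x \<in> carrier F \<Longrightarrow> I +>\<^bsub>F\<^esub> x = \<theta> (\<phi> x)"
proof -
  assume x: "x \<in> carrier F"
  have "I +>\<^bsub>F\<^esub> x = {i + x | i. i \<in> I}"
    by (auto simp: a_r_coset_def r_coset_def free_algebra_def)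
  also have "\<dots> = \<theta> (\<phi> x)"
  proof (intro equalityI subsetI)
    fix y assume "y \<in> {i + x | i. i \<in> I}"
    then obtain i where i: "y = i + x" "i \<in> I" by blast
    then show "y \<in> \<theta> (\<phi> x)"
      using F_add[OF I_F[OF i(2)] x] \<phi>_ker[OF I_F[OF i(2)]] by (simp add: \<theta>_def \<phi>_add)
  next
    fix y assume "y \<in> \<theta> (\<phi> x)"
    then have "y - x \<in> I" using \<phi>_ker[OF F_diff[of y x]] x by (auto simp: \<theta>_def \<phi>_diff)
    then show "y \<in> {i + x | i. i \<in> I}" by force
  qed
  finally show ?thesis .
qed

lemma Q_ops:
  "carrier Q = (\<lambda>x. \<theta> (\<phi> x)) ` carrier F" "\<zero>\<^bsub>Q\<^esub> = I"
  "A \<oplus>\<^bsub>Q\<^esub> B = {x + y | x y. x \<in> A \<and> y \<in> B}"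
  "A \<otimes>\<^bsub>Q\<^esub> B = (\<Union>x\<in>A. \<Union>y\<in>B. I +>\<^bsub>F\<^esub> (x * y))"
  "c \<odot>\<^bsub>Q\<^esub> A = (\<Union>x\<in>A. I +>\<^bsub>F\<^esub> mscale c x)"
proof -
  note defs = quotient_algebra_def FactRing_def ring.defs module.defs
  have "carrier Q = (\<Union>x\<in>carrier F. {I +>\<^bsub>F\<^esub> x})"
    by (simp add: defs A_RCOSETS_def RCOSETS_def a_r_coset_def)
  then show "carrier Q = (\<lambda>x. \<theta> (\<phi> x)) ` carrier F" using coset_eq by auto
  show "A \<oplus>\<^bsub>Q\<^esub> B = {x + y | x y. x \<in> A \<and> y \<in> B}"
    by (auto simp: defs set_add_def set_mult_def free_algebra_def)
qed (simp_all add: quotient_algebra_def FactRing_def ring.defs module.defs rcoset_mult_def)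

lemma \<theta>_ops:
  assumes "a \<in> \<phi> ` carrier F" "b \<in> \<phi> ` carrier F"
  shows "\<theta> a \<oplus>\<^bsub>Q\<^esub> \<theta> b = \<theta> (a + b)" "\<theta> a \<otimes>\<^bsub>Q\<^esub> \<theta> b = \<theta> (a * b)" "c \<odot>\<^bsub>Q\<^esub> \<theta> a = \<theta> (escale c a)"
proof -
  obtain x y where x: "x \<in> carrier F" "a = \<phi> x" and y: "y \<in> carrier F" "b = \<phi> y"
    using assms by blast
  show "\<theta> a \<oplus>\<^bsub>Q\<^esub> \<theta> b = \<theta> (a + b)"
    unfolding Q_ops
  proof (intro equalityI subsetI)
    fix z assume "z \<in> \<theta> (a + b)"
    then have "z = x + (z - x)" "x \<in> \<theta> a" "z - x \<in> \<theta> b"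
      using x y F_diff by (auto simp: \<theta>_def \<phi>_diff)
    then show "z \<in> {x + y | x y. x \<in> \<theta> a \<and> y \<in> \<theta> b}" by blast
  qed (auto simp: \<theta>_def \<phi>_add F_add)
  have "I +>\<^bsub>F\<^esub> (z * w) = \<theta> (a * b)" if "z \<in> \<theta> a" "w \<in> \<theta> b" for z w
    using that coset_eq[OF F_mult[of z w]] by (simp add: \<theta>_def \<phi>_mult)
  moreover have "x \<in> \<theta> a" "y \<in> \<theta> b" using x y by (auto simp: \<theta>_def)
  ultimately show "\<theta> a \<otimes>\<^bsub>Q\<^esub> \<theta> b = \<theta> (a * b)" unfolding Q_ops by blast
  have "I +>\<^bsub>F\<^esub> mscale c z = \<theta> (escale c a)" if "z \<in> \<theta> a" for z
    using that coset_eq[OF F_scale[of z c]] by (simp add: \<theta>_def \<phi>_scale)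
  with \<open>x \<in> \<theta> a\<close> show "c \<odot>\<^bsub>Q\<^esub> \<theta> a = \<theta> (escale c a)" unfolding Q_ops by blast
qed

lemma linear_model_Q: "linear_model escale (\<phi> ` carrier F) Q \<theta>"
proof -
  interpret vector_space "escale :: 'k \<Rightarrow> ('g fword, 'k) lin_endo \<Rightarrow> _" by (rule vector_space_escale)
  show ?thesis
  proof
    show "subspace (\<phi> ` carrier F)"
    proof (rule subspaceI)
      show "0 \<in> \<phi> ` carrier F" using \<phi>_zero F_zero by (metis imageI)
      show "x + y \<in> \<phi> ` carrier F" if "x \<in> \<phi> ` carrier F" "y \<in> \<phi> ` carrier F" for x y
        using that F_add \<phi>_add by (auto simp: image_iff) (metis)
      show "escale c x \<in> \<phi> ` carrier F" if "x \<in> \<phi> ` carrier F" for c x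
        using that F_scale \<phi>_scale by (auto simp: image_iff) (metis)
    qed
    have "inj_on \<theta> (\<phi> ` carrier F)"
    proof (rule inj_onI)
      fix a b assume "a \<in> \<phi> ` carrier F" "\<theta> a = \<theta> b"
      then show "a = b" by (auto simp: \<theta>_def)
    qed
    then show "bij_betw \<theta> (\<phi> ` carrier F) (carrier Q)"
      by (auto simp: bij_betw_def Q_ops)
    show "\<zero>\<^bsub>Q\<^esub> = \<theta> 0" using \<phi>_ker I_F by (auto simp: Q_ops \<theta>_def)
  qed (use \<theta>_ops in auto)
qed

lemma lie_model_Q: "lie_model escale (\<phi> ` carrier F) (commutator_algebra Q) \<theta>"
proof -
  interpret Q: linear_model escale "\<phi> ` carrier F" Q \<theta> by (rule linear_model_Q)
  have mult: "a * b \<in> \<phi> ` carrier F" if "a \<in> \<phi> ` carrier F" "b \<in> \<phi> ` carrier F" for a b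
    using that F_mult \<phi>_mult by (auto simp: image_iff) (metis)
  show ?thesis
    by unfold_locales
      (use Q.subspace_A Q.bij Q.\<theta>_add Q.\<theta>_smult Q.\<theta>_zero mult in
        \<open>auto simp: commutator_algebra_def escale_mult \<theta>_ops Q.\<theta>_minus\<close>)
qed

end


section \<open>Leavitt path algebras\<close>

definition infinite_path :: "('v, 'e) pre_digraph \<Rightarrow> (nat \<Rightarrow> 'e) \<Rightarrow> bool" where
  "infinite_path E p \<longleftrightarrow> (\<forall>n. p n \<in> arcs E \<and> head E (p n) = tail E (p (Suc n)))"

text \<open>Vertices restrict, edges prepend and ghosts delete the first edge. In a graph without
  sinks an infinite path starts at every vertex, so this action detects that vertices are
  nonzero.\<close>

fun step :: "('v, 'e) pre_digraph \<Rightarrow> ('v, 'e) lpa_gen \<Rightarrow> (nat \<Rightarrow> 'e) \<Rightarrow> (nat \<Rightarrow> 'e) option" where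
  "step E (Vertex v) p = (if tail E (p 0) = v then Some p else None)"
| "step E (Edge e) p = (if e \<in> arcs E \<and> head E e = tail E (p 0) then Some (case_nat e p) else None)"
| "step E (Ghost e) p = (if p 0 = e then Some (\<lambda>n. p (Suc n)) else None)"

fun adjoint_gen :: "('v, 'e) lpa_gen \<Rightarrow> ('v, 'e) lpa_gen" where
  "adjoint_gen (Vertex v) = Vertex v"
| "adjoint_gen (Edge e) = Ghost e"
| "adjoint_gen (Ghost e) = Edge e"

text \<open>Words act from the left, so the last letter is applied first.\<close>

fun run :: "('v, 'e) pre_digraph \<Rightarrow> ('v, 'e) lpa_gen list \<Rightarrow> (nat \<Rightarrow> 'e) \<Rightarrow> (nat \<Rightarrow> 'e) option" where
  "run E [] p = Some p"
| "run E (g # w) p = Option.bind (run E w p) (step E g)"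

lemma case_nat_shift: "case_nat (p 0) (\<lambda>n. p (Suc n)) = p"
  by (auto simp: fun_eq_iff split: nat.split)

lemma case_nat_eq_iff: "case_nat e p = q \<longleftrightarrow> q 0 = e \<and> (\<lambda>n. q (Suc n)) = p"
  using case_nat_shift[of q] by auto

lemma step_infinite_path: "infinite_path E p \<Longrightarrow> step E g p = Some q \<Longrightarrow> infinite_path E q"
  by (cases g) (auto simp: infinite_path_def split: if_splits nat.split)

text \<open>On infinite paths, prepending and deleting an edge are inverse partial maps, and
  vertices act as partial identities.\<close>

lemma step_adjoint:
  assumes "infinite_path E p" "infinite_path E q"
  shows "step E g p = Some q \<longleftrightarrow> step E (adjoint_gen g) q = Some p"
proof (cases g)
  case (Edge e)
  then show ?thesis
    using assms by (auto simp: infinite_path_def case_nat_eq_iff)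
next
  case (Ghost e)
  then show ?thesis
    using assms by (auto simp: infinite_path_def case_nat_eq_iff)
qed auto

lemma run_infinite_path: "infinite_path E p \<Longrightarrow> run E w p = Some q \<Longrightarrow> infinite_path E q"
  by (induction w arbitrary: q) (auto simp: bind_eq_Some_conv intro: step_infinite_path)

lemma run_append: "run E (w @ w') p = Option.bind (run E w' p) (run E w)"
  by (induction w) auto

text \<open>
  Words act on infinite paths by partial injections; \<open>coef E p q x\<close> is the entry of the matrix
  of \<open>x\<close> at \<open>(p, q)\<close>.
\<close>

definition coef :: "('v, 'e) pre_digraph \<Rightarrow> (nat \<Rightarrow> 'e) \<Rightarrow> (nat \<Rightarrow> 'e) \<Rightarrow>
    (('v, 'e) lpa_gen fword \<Rightarrow>\<^sub>0 'k::field) \<Rightarrow> 'k" where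
  "coef E p q x = (\<Sum>w\<in>Poly_Mapping.keys x.
     if run E (letters w) q = Some p then Poly_Mapping.lookup x w else 0)"

lemma coef_zero [simp]: "coef E p q 0 = 0"
  by (simp add: coef_def)

lemma coef_add: "coef E p q (x + y) = coef E p q x + coef E p q y"
  unfolding coef_def
  by (rule setsum_keys_plus_distrib[where f = "\<lambda>w c. if run E (letters w) q = Some p then c else 0"]) auto

lemma coef_diff: "coef E p q (x - y) = coef E p q x - coef E p q y"
  using coef_add[of E p q "x - y" y] by simp

lemma coef_sum: "coef E p q (\<Sum>i\<in>A. f i) = (\<Sum>i\<in>A. coef E p q (f i))"
  by (induction A rule: infinite_finite_induct) (auto simp: coef_add)

lemma coef_single:
  "coef E p q (Poly_Mapping.single w c) = (if run E (letters w) q = Some p then c else 0)"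
  by (simp add: coef_def)

lemma plus_fword_simps [simp]: "FWord u + FWord w = FWord (u @ w)"
  by (simp add: plus_fword_def)

lemma gen_mult_single: "gen g * Poly_Mapping.single w c = Poly_Mapping.single (FWord (g # letters w)) c"
  by (simp add: gen_def mult_single plus_fword_def)

lemma single_mult_gen:
  "Poly_Mapping.single w c * gen g = Poly_Mapping.single (FWord (letters w @ [g])) c"
  by (simp add: gen_def mult_single plus_fword_def)

lemma coef_mscale: "coef E p q (mscale c x) = c * coef E p q x"
  by (induction x rule: single_induct)
    (auto simp: mult_single coef_single coef_add distrib_left)

text \<open>As \<open>g\<close> acts by a partial injection, row \<open>p\<close> of the product
  comes from a single row of \<open>x\<close>, found by applying the adjoint generator to
  \<open>p\<close>.\<close>

lemma coef_gen_left:
  assumes "infinite_path E p" "infinite_path E q"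
  shows "coef E p q (gen g * x) =
    (case step E (adjoint_gen g) p of None \<Rightarrow> 0 | Some p' \<Rightarrow> coef E p' q x)"
proof (induction x rule: single_induct)
  case (single w c)
  have "run E (g # letters w) q = Some p \<longleftrightarrow>
      (\<exists>r. run E (letters w) q = Some r \<and> step E (adjoint_gen g) p = Some r)"
    using step_adjoint[OF run_infinite_path[OF assms(2)] assms(1)]
    by (auto simp: bind_eq_Some_conv)
  then show ?case by (auto simp: gen_mult_single coef_single split: option.split)
qed (auto simp: distrib_left coef_add split: option.split)

lemma coef_gen_right:
  "coef E p q (x * gen g) = (case step E g q of None \<Rightarrow> 0 | Some q' \<Rightarrow> coef E p q' x)"
proof (induction x rule: single_induct)
  case (single w c)
  show ?case
    by (auto simp: single_mult_gen coef_single run_append split: option.split)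
qed (auto simp: distrib_right coef_add split: option.split)

section \<open>The kernel of the representation\<close>

definition null_ideal :: "('v, 'e) pre_digraph \<Rightarrow> (('v, 'e) lpa_gen fword \<Rightarrow>\<^sub>0 'k::field) set" where
  "null_ideal E = {x. \<forall>p q. infinite_path E p \<longrightarrow> infinite_path E q \<longrightarrow> coef E p q x = 0}"

lemma null_ideal_left_gen: "x \<in> null_ideal E \<Longrightarrow> gen g * x \<in> null_ideal E"
  using step_infinite_path by (fastforce simp: null_ideal_def coef_gen_left split: option.split)

lemma null_ideal_right_gen: "x \<in> null_ideal E \<Longrightarrow> x * gen g \<in> null_ideal E"
  using step_infinite_path by (fastforce simp: null_ideal_def coef_gen_right split: option.split)

lemma null_ideal_add: "x \<in> null_ideal E \<Longrightarrow> y \<in> null_ideal E \<Longrightarrow> x + y \<in> null_ideal E"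
  by (simp add: null_ideal_def coef_add)

lemma null_ideal_mscale: "x \<in> null_ideal E \<Longrightarrow> mscale c x \<in> null_ideal E"
  by (simp add: null_ideal_def coef_mscale)

lemma null_ideal_left: "x \<in> null_ideal E \<Longrightarrow> a * x \<in> null_ideal E"
proof (induction a rule: single_induct)
  case (single k c)
  have "Poly_Mapping.single (FWord w) c * x \<in> null_ideal E" for w
  proof (induction w)
    case Nil
    then show ?case using null_ideal_mscale[OF single(2)] by (simp add: zero_fword_def)
  next
    case (Cons g w)
    have "Poly_Mapping.single (FWord (g # w)) c * x = gen g * (Poly_Mapping.single (FWord w) c * x)"
      by (simp add: gen_mult_single mult.assoc[symmetric])
    then show ?case using null_ideal_left_gen[OF Cons] by simp
  qed
  from this[of "letters k"] show ?case by simp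
qed (auto simp: distrib_right null_ideal_def coef_add)

lemma null_ideal_right: "x \<in> null_ideal E \<Longrightarrow> x * a \<in> null_ideal E"
proof (induction a rule: single_induct)
  case (single k c)
  have "x * Poly_Mapping.single (FWord w) c \<in> null_ideal E" if "x \<in> null_ideal E" for x w
    using that
  proof (induction w arbitrary: x)
    case Nil
    then show ?case using null_ideal_mscale[OF Nil] mult_mscale[of x c 1] by (simp add: zero_fword_def)
  next
    case (Cons g w)
    have "x * Poly_Mapping.single (FWord (g # w)) c = x * gen g * Poly_Mapping.single (FWord w) c"
      by (simp add: gen_mult_single mult.assoc)
    then show ?case using Cons.IH[OF null_ideal_right_gen[OF Cons.prems]] by simp
  qed
  from this[of x "letters k"] single(2) show ?case by simp
qed (auto simp: distrib_left null_ideal_def coef_add)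

lemma coef_gen: "coef E p q (gen g) = (if step E g q = Some p then 1 else 0)"
  by (simp add: gen_def coef_single)

lemma coef_gen_gen:
  "coef E p q (gen g * gen h) = (if Option.bind (step E h q) (step E g) = Some p then 1 else 0)"
  by (simp add: gen_def mult_single coef_single)

lemma relations_null_ideal:
  fixes E :: "('v, 'e) pre_digraph"
  shows "(lpa_relations E :: (('v, 'e) lpa_gen fword \<Rightarrow>\<^sub>0 'k::field) set) \<subseteq> null_ideal E"
proof
  fix x :: "('v, 'e) lpa_gen fword \<Rightarrow>\<^sub>0 'k"
  assume x: "x \<in> lpa_relations E"
  have "coef E p q x = 0" if p: "infinite_path E p" and q: "infinite_path E q" for p q
  proof -
    have q': "\<And>n. q n \<in> arcs E" "\<And>n. head E (q n) = tail E (q (Suc n))"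
      using q by (auto simp: infinite_path_def)
    have sum: "coef E p q (\<Sum>e\<in>out_arcs E v. gen (Edge e) * gen (Ghost e)) =
        (coef E p q (gen (Vertex v)) :: 'k)" if "regular E v" for v
    proof -
      \<comment> \<open>Only the first edge of \<open>q\<close> contributes to the sum; deleting and
        restoring it returns \<open>q\<close>, which is also how the vertex acts.\<close>
      have "coef E p q (gen (Edge e) * gen (Ghost e)) = (if e = q 0 then if q = p then 1 else 0 else 0 :: 'k)" for e
        using q' case_nat_shift[of q] by (auto simp: coef_gen_gen)
      then have "coef E p q (\<Sum>e\<in>out_arcs E v. gen (Edge e) * gen (Ghost e)) =
          (\<Sum>e\<in>out_arcs E v. if e = q 0 then if q = p then 1 else 0 else 0 :: 'k)"
        by (simp add: coef_sum)
      also have "\<dots> = coef E p q (gen (Vertex v))"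
        using that q' by (auto simp: regular_def coef_gen)
      finally show ?thesis .
    qed
    from x show ?thesis
      unfolding lpa_relations_def
      by (elim UnE CollectE exE conjE)
        (auto simp: coef_diff coef_gen coef_gen_gen sum q' split: if_splits)
  qed
  then show "x \<in> null_ideal E" by (simp add: null_ideal_def)
qed

lemma ideal_null_ideal: "x \<in> ideal_generated (free_algebra X) (lpa_relations E) \<Longrightarrow> x \<in> null_ideal E"
proof (induction rule: ideal_generated.induct)
  case zero
  then show ?case by (simp add: free_algebra_def null_ideal_def)
next
  case (rel x)
  then show ?case using relations_null_ideal by blast
qed (simp_all add: free_algebra_def null_ideal_add null_ideal_mscale null_ideal_left null_ideal_right)

lemma infinite_path_exists:
  assumes "wf_digraph E" "\<And>v. v \<in> verts E \<Longrightarrow> \<exists>e\<in>arcs E. tail E e = v" "v \<in> verts E"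
  shows "\<exists>p. infinite_path E p \<and> tail E (p 0) = v"
proof -
  interpret wf_digraph E by (rule assms(1))
  have "\<exists>p. \<forall>n. (p n \<in> arcs E \<and> (n = 0 \<longrightarrow> tail E (p n) = v)) \<and> head E (p n) = tail E (p (Suc n))"
  proof (rule dependent_nat_choice)
    show "\<exists>x. x \<in> arcs E \<and> ((0::nat) = 0 \<longrightarrow> tail E x = v)" using assms(2)[OF assms(3)] by blast
    fix x and n :: nat assume "x \<in> arcs E \<and> (n = 0 \<longrightarrow> tail E x = v)"
    then show "\<exists>y. (y \<in> arcs E \<and> (Suc n = 0 \<longrightarrow> tail E y = v)) \<and> head E x = tail E y"
      using assms(2)[of "head E x"] by auto
  qed
  then show ?thesis unfolding infinite_path_def by blast
qed

text \<open>An infinite path that starts at \<open>v\<close> gives a diagonal matrix entry equal to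
  1.\<close>

lemma vertex_not_in_ideal:
  assumes "wf_digraph E" "\<And>v. v \<in> verts E \<Longrightarrow> \<exists>e\<in>arcs E. tail E e = v" "v \<in> verts E"
  shows "gen (Vertex v) \<notin> ideal_generated (free_algebra X) (lpa_relations E)"
proof -
  obtain p where "infinite_path E p" "tail E (p 0) = v" using infinite_path_exists[OF assms] by blast
  then have "gen (Vertex v) \<notin> null_ideal E" by (auto simp: null_ideal_def coef_gen)
  then show ?thesis using ideal_null_ideal by blast
qed

section \<open>The commutator algebra of a Leavitt path algebra\<close>

lemma lpa_relationsI:
  "v \<in> verts E \<Longrightarrow> w \<in> verts E \<Longrightarrow>
    gen (Vertex v) * gen (Vertex w) - (if v = w then gen (Vertex v) else 0) \<in> lpa_relations E"
  "e \<in> arcs E \<Longrightarrow> gen (Vertex (tail E e)) * gen (Edge e) - gen (Edge e) \<in> lpa_relations E"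
  "e \<in> arcs E \<Longrightarrow> gen (Edge e) * gen (Vertex (head E e)) - gen (Edge e) \<in> lpa_relations E"
  "e \<in> arcs E \<Longrightarrow> gen (Vertex (head E e)) * gen (Ghost e) - gen (Ghost e) \<in> lpa_relations E"
  "e \<in> arcs E \<Longrightarrow> gen (Ghost e) * gen (Vertex (tail E e)) - gen (Ghost e) \<in> lpa_relations E"
  "e \<in> arcs E \<Longrightarrow> f \<in> arcs E \<Longrightarrow>
    gen (Ghost e) * gen (Edge f) - (if e = f then gen (Vertex (head E e)) else 0) \<in> lpa_relations E"
  "regular E v \<Longrightarrow>
    gen (Vertex v) - (\<Sum>e\<in>out_arcs E v. gen (Edge e) * gen (Ghost e)) \<in> lpa_relations E"
  unfolding lpa_relations_def by blast+

lemma gen_in_free_algebra: "x \<in> X \<Longrightarrow> gen x \<in> carrier (free_algebra X)"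
  by (simp add: gen_def free_algebra_def)

lemma lpa_relations_carrier:
  assumes "wf_digraph E"
  shows "lpa_relations E \<subseteq> carrier (free_algebra (lpa_gens E))"
proof -
  interpret wf_digraph E by (rule assms)
  interpret presented_algebra "lpa_gens E" "{}" by unfold_locales simp
  have gens: "v \<in> verts E \<Longrightarrow> gen (Vertex v) \<in> carrier F" "e \<in> arcs E \<Longrightarrow> gen (Edge e) \<in> carrier F"
    "e \<in> arcs E \<Longrightarrow> gen (Ghost e) \<in> carrier F" for v e
    by (auto simp: lpa_gens_def intro!: gen_in_free_algebra)
  have sum: "(\<Sum>i\<in>A. f i) \<in> carrier F" if "\<And>i. i \<in> A \<Longrightarrow> f i \<in> carrier F" for A and f :: "'e \<Rightarrow> _"
    using that by (induction A rule: infinite_finite_induct) (auto intro: F_add)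
  show ?thesis
    unfolding lpa_relations_def
    by (auto intro!: F_diff F_mult gens sum simp: regular_def)
qed

text \<open>The images of the generators under \<open>\<phi>\<close> form an acyclic Leavitt family.
  Once \<open>A.alg\<close> is identified with the image of the free algebra, the four claims follow
  from the results on families and on Lie models.\<close>

theorem lie_algebra_of_acyclic_graph_without_sinks:
  fixes E :: "('v, 'e) pre_digraph"
  assumes "wf_digraph E" "verts E \<noteq> {}" "acyclic_graph E"
    and no_sink: "\<And>v. v \<in> verts E \<Longrightarrow> \<exists>e\<in>arcs E. tail E e = v"
  defines "L \<equiv> commutator_algebra (leavitt_path_algebra TYPE('k::field) E)"
  shows "lie_algebra class_ring L" "locally_finite class_ring L"
    "\<not> finite_dimensional class_ring L (carrier L)" "semisimple class_ring L"
proof -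
  interpret wf_digraph E by (rule assms(1))
  let ?R = "lpa_relations E :: (('v, 'e) lpa_gen fword \<Rightarrow>\<^sub>0 'k) set"
  interpret P: presented_algebra "lpa_gens E" ?R
    by unfold_locales (rule lpa_relations_carrier[OF assms(1)])
  obtain \<phi> where "quotient_model (lpa_gens E) ?R \<phi>"
    using P.quotient_model_exists by blast
  then interpret Q: quotient_model "lpa_gens E" ?R \<phi> .
  interpret L: lie_model escale "\<phi> ` carrier P.F" L Q.\<theta>
    using Q.lie_model_Q by (simp add: L_def leavitt_path_algebra_def Let_def)
  have gens: "v \<in> verts E \<Longrightarrow> gen (Vertex v) \<in> carrier P.F" "e \<in> arcs E \<Longrightarrow> gen (Edge e) \<in> carrier P.F"
    "e \<in> arcs E \<Longrightarrow> gen (Ghost e) \<in> carrier P.F" for v e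
    by (auto simp: lpa_gens_def intro!: gen_in_free_algebra)
  have rel: "\<phi> x = 0" if "x \<in> ?R" for x
    using Q.\<phi>_ker[OF P.I_F] ideal_generated.rel[OF that] by blast
  have eq: "\<phi> x = \<phi> y" if "x - y \<in> ?R" for x y
    using rel[OF that] by (simp add: Q.\<phi>_diff)
  have \<phi>_sum: "\<phi> (\<Sum>i\<in>A. f i) = (\<Sum>i\<in>A. \<phi> (f i))" for A and f :: "'e \<Rightarrow> _"
    by (induction A rule: infinite_finite_induct) (auto simp: Q.\<phi>_zero Q.\<phi>_add)
  interpret A: acyclic_leavitt_family escale E "\<lambda>v. \<phi> (gen (Vertex v))" "\<lambda>e. \<phi> (gen (Edge e))"
    "\<lambda>e. \<phi> (gen (Ghost e))"
  proof unfold_locales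
    fix v w :: 'v and e f :: 'e
    show "\<phi> (gen (Vertex v)) * \<phi> (gen (Vertex w)) = (if v = w then \<phi> (gen (Vertex v)) else 0)"
      if "v \<in> verts E" "w \<in> verts E"
      using eq[OF lpa_relationsI(1)[OF that]] by (auto simp: Q.\<phi>_mult Q.\<phi>_zero split: if_splits)
    show "\<phi> (gen (Vertex (tail E e))) * \<phi> (gen (Edge e)) = \<phi> (gen (Edge e))" if "e \<in> arcs E"
      using eq[OF lpa_relationsI(2)[OF that]] by (auto simp: Q.\<phi>_mult Q.\<phi>_zero split: if_splits)
    show "\<phi> (gen (Edge e)) * \<phi> (gen (Vertex (head E e))) = \<phi> (gen (Edge e))" if "e \<in> arcs E"
      using eq[OF lpa_relationsI(3)[OF that]] by (auto simp: Q.\<phi>_mult Q.\<phi>_zero split: if_splits)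
    show "\<phi> (gen (Vertex (head E e))) * \<phi> (gen (Ghost e)) = \<phi> (gen (Ghost e))" if "e \<in> arcs E"
      using eq[OF lpa_relationsI(4)[OF that]] by (auto simp: Q.\<phi>_mult Q.\<phi>_zero split: if_splits)
    show "\<phi> (gen (Ghost e)) * \<phi> (gen (Vertex (tail E e))) = \<phi> (gen (Ghost e))" if "e \<in> arcs E"
      using eq[OF lpa_relationsI(5)[OF that]] by (auto simp: Q.\<phi>_mult Q.\<phi>_zero split: if_splits)
    show "\<phi> (gen (Ghost e)) * \<phi> (gen (Edge f)) = (if e = f then \<phi> (gen (Vertex (head E e))) else 0)"
      if "e \<in> arcs E" "f \<in> arcs E"
      using eq[OF lpa_relationsI(6)[OF that]] by (auto simp: Q.\<phi>_mult Q.\<phi>_zero split: if_splits)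
    show "\<phi> (gen (Vertex v)) = (\<Sum>e\<in>out_arcs E v. \<phi> (gen (Edge e)) * \<phi> (gen (Ghost e)))"
      if "regular E v"
      using eq[OF lpa_relationsI(7)[OF that]] by (auto simp: Q.\<phi>_mult Q.\<phi>_zero \<phi>_sum split: if_splits)
    show "\<phi> (gen (Vertex v)) \<noteq> 0" if "v \<in> verts E"
      using Q.\<phi>_ker[OF gens(1)[OF that]] vertex_not_in_ideal[OF assms(1) no_sink that] by blast
  qed (use assms(3) no_sink escale_mult in auto)
  \<comment> \<open>Path and ghost elements are products of generators, which gives one inclusion.
    For the other, \<open>A.alg\<close> is closed under products and so contains the image of every
    non-empty word.\<close>
  have alg: "A.alg = \<phi> ` carrier P.F"
  proof
    have paths: "A.path_el u q \<in> \<phi> ` carrier P.F \<and> A.ghost_el u q \<in> \<phi> ` carrier P.F"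
      if "awalk u q w" for u q w
      using that
      by (induction q arbitrary: u) (auto simp: awalk_simps intro!: L.A_mult imageI gens)
    have "A.monomials UNIV UNIV \<subseteq> \<phi> ` carrier P.F"
    proof
      fix x assume "x \<in> A.monomials UNIV UNIV"
      then obtain u a v b w where x: "x = A.path_el u a * A.ghost_el v b" "awalk u a w" "awalk v b w"
        unfolding A.monomials_def by blast
      show "x \<in> \<phi> ` carrier P.F"
        unfolding x(1) by (rule L.A_mult) (use paths[OF x(2)] paths[OF x(3)] in blast)+
    qed
    then show "A.alg \<subseteq> \<phi> ` carrier P.F"
      unfolding A.alg_def by (rule L.span_minimal) (rule L.subspace_A)
    show "\<phi> ` carrier P.F \<subseteq> A.alg"
    proof (rule image_subsetI)
      fix x assume x: "x \<in> carrier P.F"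
      have gen_alg: "\<phi> (gen g) \<in> A.alg" if "g \<in> lpa_gens E" for g
        using that A.V_in_alg A.S_in_alg A.T_in_alg by (auto simp: lpa_gens_def)
      have word: "\<phi> (Poly_Mapping.single (FWord w) 1) \<in> A.alg" if "w \<noteq> []" "set w \<subseteq> lpa_gens E" for w
        using that
      proof (induction w rule: list_nonempty_induct)
        case (single g)
        then show ?case using gen_alg by (simp add: gen_def)
      next
        case (cons g w)
        have "\<phi> (Poly_Mapping.single (FWord (g # w)) 1) = \<phi> (gen g) * \<phi> (Poly_Mapping.single (FWord w) 1)"
          by (simp add: Q.\<phi>_mult[symmetric] gen_mult_single)
        then show ?case using cons gen_alg A.alg_mult by simp
      qed
      have "\<phi> (\<Sum>k\<in>K. Poly_Mapping.single k (Poly_Mapping.lookup x k)) \<in> A.alg"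
        if "finite K" "K \<subseteq> Poly_Mapping.keys x" for K
        using that
      proof (induction rule: finite_induct)
        case empty
        then show ?case using L.subspace_0[OF A.subspace_alg] by (simp add: Q.\<phi>_zero)
      next
        case (insert k K)
        have "Poly_Mapping.single k (Poly_Mapping.lookup x k) =
            mscale (Poly_Mapping.lookup x k) (Poly_Mapping.single (FWord (letters k)) 1)"
          by (simp add: mult_single)
        moreover have "letters k \<noteq> []" "set (letters k) \<subseteq> lpa_gens E"
          using x insert.prems by (auto simp: P.mem_F)
        ultimately have "\<phi> (Poly_Mapping.single k (Poly_Mapping.lookup x k)) \<in> A.alg"
          using L.subspace_scale[OF A.subspace_alg word[of "letters k"]] by (simp add: Q.\<phi>_scale)
        then show ?case
          using insert L.subspace_add[OF A.subspace_alg] by (simp add: Q.\<phi>_add)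
      qed
      from this[of "Poly_Mapping.keys x"] show "\<phi> x \<in> A.alg" by (simp add: sum_single_lookup)
    qed
  qed
  show "lie_algebra class_ring L" by (rule L.lie_algebra_L)
  show "locally_finite class_ring L"
  proof (rule L.locally_finite_L)
    fix X assume "finite X" "X \<subseteq> \<phi> ` carrier P.F"
    then show "\<exists>B. finite B \<and> B \<subseteq> \<phi> ` carrier P.F \<and> X \<subseteq> L.span B \<and>
        (\<forall>x\<in>L.span B. \<forall>y\<in>L.span B. x * y \<in> L.span B)"
      using A.alg_locally_finite[OF assms(3)] A.span_mult_closed unfolding alg by metis
  qed
  show "\<not> finite_dimensional class_ring L (carrier L)"
    unfolding L.carrier_L L.finite_dimensional_image[OF order_refl L.subspace_A]
    using A.alg_infinite_dimensional[OF assms(2)] unfolding alg by blast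
  show "semisimple class_ring L"
  proof (rule L.semisimple_L)
    fix J x assume J: "L.subspace J" "J \<subseteq> \<phi> ` carrier P.F"
      "\<And>a x. a \<in> \<phi> ` carrier P.F \<Longrightarrow> x \<in> J \<Longrightarrow> a * x - x * a \<in> J" "x \<in> J" "x \<noteq> 0"
    obtain B R where BR: "finite B" "B \<subseteq> A.alg" "\<forall>x\<in>B. \<forall>y\<in>B. x * y \<in> L.span B"
      "R \<subseteq> J \<inter> L.span B" "R \<noteq> {}" "0 \<notin> R" "\<forall>x\<in>R. \<exists>y\<in>R. \<exists>z\<in>R. x = y * z - z * y"
      using A.lie_ideal_nonsolvable[of J x] J unfolding alg by blast
    moreover have "\<forall>x\<in>L.span B. \<forall>y\<in>L.span B. x * y \<in> L.span B"
      using A.span_mult_closed[of B] BR(3) by blast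
    ultimately show "\<exists>B R. finite B \<and> B \<subseteq> \<phi> ` carrier P.F \<and>
        (\<forall>x\<in>L.span B. \<forall>y\<in>L.span B. x * y \<in> L.span B) \<and> R \<subseteq> J \<inter> L.span B \<and>
        R \<noteq> {} \<and> 0 \<notin> R \<and> (\<forall>x\<in>R. \<exists>y\<in>R. \<exists>z\<in>R. x = y * z - z * y)"
      unfolding alg by blast
  qed
qed

section \<open>Porcupine graphs and the two cases\<close>

lemma regular_imp_arc: "regular E v \<Longrightarrow> \<exists>e\<in>arcs E. tail E e = v"
  by (auto simp: regular_def)

text \<open>By heredity a walk that starts in \<open>H\<close> stays in \<open>H\<close>, so all its
  edges survive in the porcupine graph.\<close>

lemma porcupine_awalk:
  assumes "wf_digraph E" "hereditary E H"
    and "u \<in> H" "pre_digraph.awalk E u q w"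
  shows "pre_digraph.awalk (porcupine E H v) (Inl u) (map Inl q) (Inl w)"
proof -
  interpret wf_digraph E by (rule assms(1))
  have head: "head E e \<in> H" if "e \<in> arcs E" "tail E e \<in> H" for e
  proof -
    have "awalk (tail E e) [e] (head E e)" using that(1) by (simp add: awalk_simps)
    then show ?thesis using assms(2) that(2) unfolding hereditary_def by blast
  qed
  show ?thesis
    using assms(3,4)
  proof (induction q arbitrary: u)
    case Nil
    then show ?case
      by (auto simp: awalk_simps pre_digraph.awalk_def pre_digraph.cas.simps porcupine_def)
  next
    case (Cons e q)
    then have e: "e \<in> arcs E" "tail E e = u" "awalk (head E e) q w" by (auto simp: awalk_simps)
    show ?case
      using Cons.IH[OF head e(3)] e Cons.prems(1)
      by (auto simp: pre_digraph.awalk_def pre_digraph.cas.simps porcupine_def)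
  qed
qed

text \<open>A closed walk based in \<open>H\<close> transfers to the porcupine graph. One based at
  \<open>v\<close> would need a last edge entering the source \<open>v\<close>.\<close>

lemma porcupine_acyclic:
  assumes "wf_digraph E" "verts E = H \<union> {v}" "hereditary E H" "is_source E v"
    and "acyclic_graph (porcupine E H v)"
  shows "acyclic_graph E"
proof -
  interpret wf_digraph E by (rule assms(1))
  have "q = []" if q: "awalk u q u" for u q
  proof (cases "u \<in> H")
    case True
    have "map Inl q = []"
      using porcupine_awalk[OF assms(1,3) True q, of v] assms(5) unfolding acyclic_graph_def by blast
    then show ?thesis by simp
  next
    case False
    then have "u = v" using awalk_hd_in_verts[OF q] assms(2) by auto
    show ?thesis
    proof (rule ccontr)
      assume "q \<noteq> []"
      then obtain q' e where "q = q' @ [e]" by (metis rev_exhaust)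
      then have "e \<in> in_arcs E v" using q \<open>u = v\<close> by (auto simp: awalk_simps)
      then show False using assms(4) unfolding is_source_def by blast
    qed
  qed
  then show ?thesis unfolding acyclic_graph_def by blast
qed

theorem corollary4p11:
  fixes E :: "('v, 'e) pre_digraph" and p :: nat
  assumes char: "CHAR('k::field) = p" "p > 0"
    and graph: "wf_digraph E" "verts E \<noteq> {}"
    and cases: "p_commutator_graph p E \<or>
      (\<exists>H v. H \<noteq> {} \<and> v \<notin> H \<and> verts E = H \<union> {v} \<and>
         hereditary E H \<and> saturated E H \<and>
         p_commutator_graph p (porcupine E H v) \<and>
         {w. infinite_emitter E w} = {v} \<and> is_source E v)"
  defines "L \<equiv> commutator_algebra (leavitt_path_algebra TYPE('k) E)"
  shows "lie_algebra class_ring L \<and>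
    locally_finite class_ring L \<and>
    \<not> finite_dimensional class_ring L (carrier L) \<and>
    semisimple class_ring L"
proof -
  \<comment> \<open>Both alternatives lead to the same two properties: no cycles and no
    sinks.\<close>
  have "acyclic_graph E \<and> (\<forall>u\<in>verts E. \<exists>e\<in>arcs E. tail E e = u)"
    using cases
  proof (elim disjE exE conjE)
    assume "p_commutator_graph p E"
    then show ?thesis using regular_imp_arc[of E] unfolding p_commutator_graph_def by blast
  next
    fix H v
    assume H: "verts E = H \<union> {v}" "hereditary E H" "is_source E v"
      and pc: "p_commutator_graph p (porcupine E H v)" and v: "{w. infinite_emitter E w} = {v}"
    have "\<exists>e\<in>arcs E. tail E e = u" if u: "u \<in> H" for u
    proof -
      \<comment> \<open>An edge leaving \<open>Inl u\<close> in the porcupine graph must be an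
        \<open>Inl\<close> copy of an edge of \<open>E\<close>, because the new edges leave the new
        vertices.\<close>
      have "regular (porcupine E H v) (Inl u)"
        using pc u by (auto simp: p_commutator_graph_def porcupine_def)
      then show ?thesis using regular_imp_arc by (fastforce simp: porcupine_def)
    qed
    moreover have "\<exists>e\<in>arcs E. tail E e = v"
    proof -
      have "infinite (out_arcs E v)" using v by (auto simp: infinite_emitter_def)
      then have "out_arcs E v \<noteq> {}" by auto
      then show ?thesis by auto
    qed
    moreover have "acyclic_graph E"
      using porcupine_acyclic[OF graph(1) H] pc by (simp add: p_commutator_graph_def)
    ultimately show ?thesis using H(1) by auto
  qed
  then show ?thesis
    using lie_algebra_of_acyclic_graph_without_sinks[OF graph, where 'k = 'k] unfolding L_def by blast
qed

end
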